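(* Let $n\ge 2$ be an integer and let $\mathbb{F}$ be an algebraically closed field of characteristic $0$. Let $\Gamma\subset \mathrm{SL}^{\pm}(n+1,\mathbb{F})$ be an $\mathbb{F}$-Zariski-dense subgroup (that is, Zariski-dense in $\mathrm{SL}^{\pm}(n+1,\mathbb{F})$) generated by finitely many reflections. Let $\Delta$ be any subgroup of finite index in $\Gamma$, and let $\mathbb{A}$ be an integrally closed Noetherian ring in $\mathbb{F}$. Then the following are equivalent: (a) $\Gamma$ is definable over $\mathbb{A}$; (a$'$) $\mathbb{A}$ contains all the simple cyclic products of the Cartan matrix of $\Gamma$; (b) $\Delta$ is definable over $\mathbb{A}$.
   Context: $\mathrm{SL}^{\pm}(n+1,\mathbb{F})=\{A\in \mathrm{GL}(n+1,\mathbb{F}) : \det A=\pm1\}$, $V=\mathbb{F}^{n+1}$. A reflection is an element of order 2 of $\mathrm{SL}^{\pm}(n+1,\mathbb{F})$ that is the identity on a hyperplane; it has the form $\sigma=I-\alpha\otimes\vec v$, i.e. $\vec x\mapsto\vec x-\alpha(\vec x)\vec v$, with $\alpha\in V^*$, $\vec v\in V$, $\alpha(\vec v)=2$. If $\Gamma$ is generated by the reflections $\sigma_i=I-\alpha_i\otimes\vec v_i$, its Cartan matrix is $C=(c_{ij})$ with $c_{ij}=\alpha_i(\vec v_j)$. A cyclic product is $c_{i_1i_2}c_{i_2i_3}\cdots c_{i_ki_1}$; it is simple if the indices $i_1,\dots,i_k$ are distinct. (Cyclic products do not depend on the choice of the pairs $(\alpha_i,\vec v_i)$, each determined by $\sigma_i$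 up to $(\alpha_i,\vec v_i)\mapsto(c^{-1}\alpha_i,c\vec v_i)$, $c\neq0$.) For a subring $\mathbb{A}$ of $\mathbb{F}$, an $\mathbb{A}$-lattice in $V$ is a finitely generated $\mathbb{A}$-submodule $L\subset V$ such that the natural map $\mathbb{F}\otimes_{\mathbb{A}}L\to V$ is an isomorphism. A group of linear automorphisms of $V$ is definable over $\mathbb{A}$ if $V$ contains an $\mathbb{A}$-lattice invariant under it. *)

theory Defs
  imports
    "HOL-Analysis.Analysis"
    "HOL-Algebra.Algebra"
    "HOL-Algebra.Free_Abelian_Groups"
    "HOL-Algebra.Algebraic_Closure_Type"
begin

text \<open>
  The space \<open>V\<close> is \<open>'f ^ 'd\<close>, and linear automorphisms of \<open>V\<close> are square matrices acting by
  \<open>*v\<close>. The underlying field is a type \<open>'f\<close>; subrings are sets \<open>A :: 'f set\<close>.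
\<close>

section \<open>The group \<open>SL\<^sup>\<plusminus>\<close> and its Zariski topology\<close>

definition SLpm :: "('f::field ^ 'd ^ 'd) monoid" where
  "SLpm = \<lparr>carrier = {g. det g = 1 \<or> det g = - 1}, monoid.mult = (**), one = mat 1\<rparr>"

lemma group_SLpm: "group (SLpm :: ('f::field ^ 'd ^ 'd) monoid)"
proof (rule groupI)
  fix g :: "'f ^ 'd ^ 'd"
  assume "g \<in> carrier SLpm"
  then have d: "det g = 1 \<or> det g = - 1" by (simp add: SLpm_def)
  then have "invertible g" by (auto simp: invertible_det_nz)
  then obtain h where h: "h ** g = mat 1" by (auto simp: invertible_def)
  then have "det h * det g = 1" by (metis det_I det_mul)
  with d have "det h = 1 \<or> det h = - 1"
    by (metis mult.right_neutral mult_minus_right minus_minus)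
  with h show "\<exists>h\<in>carrier SLpm. h \<otimes>\<^bsub>SLpm\<^esub> g = \<one>\<^bsub>SLpm\<^esub>"
    by (auto simp: SLpm_def)
qed (auto simp: SLpm_def det_mul det_I matrix_mul_assoc)

inductive_set matrix_polyfun :: "('f::field ^ 'd ^ 'd \<Rightarrow> 'f) set" where
  const: "(\<lambda>_. c) \<in> matrix_polyfun"
| entry: "(\<lambda>M. M $ i $ j) \<in> matrix_polyfun"
| add: "p \<in> matrix_polyfun \<Longrightarrow> q \<in> matrix_polyfun \<Longrightarrow> (\<lambda>M. p M + q M) \<in> matrix_polyfun"
| mult: "p \<in> matrix_polyfun \<Longrightarrow> q \<in> matrix_polyfun \<Longrightarrow> (\<lambda>M. p M * q M) \<in> matrix_polyfun"

definition zariski_closed :: "('f::field ^ 'd ^ 'd) set \<Rightarrow> bool" where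
  "zariski_closed Z \<longleftrightarrow> (\<exists>P \<subseteq> matrix_polyfun. Z = {M. \<forall>p\<in>P. p M = 0})"

text \<open>
  Density refers to the subspace topology on \<open>SL\<^sup>\<plusminus>\<close>, which is itself closed in the space of all
  matrices; the function \<open>1 / det\<close> restricts to \<open>det\<close> there and so gives no further closed sets.
\<close>

definition zariski_dense_in_SLpm :: "('f::field ^ 'd ^ 'd) set \<Rightarrow> bool" where
  "zariski_dense_in_SLpm S \<longleftrightarrow>
     S \<subseteq> carrier SLpm \<and> (\<forall>Z. zariski_closed Z \<and> S \<subseteq> Z \<longrightarrow> carrier SLpm \<subseteq> Z)"


section \<open>Reflections and cyclic products\<close>

definition reflection :: "'f::field ^ 'd ^ 'd \<Rightarrow> bool" where
  "reflection \<sigma> \<longleftrightarrow>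
     \<sigma> \<in> carrier SLpm \<and> group.ord SLpm \<sigma> = 2 \<and>
     (\<exists>H. vec.subspace H \<and> vec.dim H + 1 = CARD('d) \<and> (\<forall>x\<in>H. \<sigma> *v x = x))"

text \<open>\<open>\<sigma> = I - \<alpha> \<otimes> v\<close>, where \<open>\<alpha>\<close> is a linear functional with \<open>\<alpha>(v) = 2\<close>.\<close>

definition reflection_form :: "'f::field ^ 'd ^ 'd \<Rightarrow> ('f ^ 'd \<Rightarrow> 'f) \<Rightarrow> 'f ^ 'd \<Rightarrow> bool" where
  "reflection_form \<sigma> \<alpha> v \<longleftrightarrow>
     Vector_Spaces.linear (*s) (*) \<alpha> \<and> \<alpha> v = 2 \<and> (\<forall>x. \<sigma> *v x = x - \<alpha> x *s v)"

definition cartan_matrix :: "('i \<Rightarrow> 'f ^ 'd \<Rightarrow> 'f) \<Rightarrow> ('i \<Rightarrow> 'f ^ 'd) \<Rightarrow> 'i \<Rightarrow> 'i \<Rightarrow> 'f" where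
  "cartan_matrix \<alpha> v i j = \<alpha> i (v j)"

definition cyclic_product :: "('i \<Rightarrow> 'i \<Rightarrow> 'f::field) \<Rightarrow> 'i list \<Rightarrow> 'f" where
  "cyclic_product C is = (\<Prod>k<length is. C (is ! k) (is ! (Suc k mod length is)))"

definition simple_cyclic_products :: "'i set \<Rightarrow> ('i \<Rightarrow> 'i \<Rightarrow> 'f::field) \<Rightarrow> 'f set" where
  "simple_cyclic_products I C =
     {cyclic_product C is | is. is \<noteq> [] \<and> distinct is \<and> set is \<subseteq> I}"


section \<open>Integrally closed Noetherian subrings\<close>

definition fraction_field_in :: "'f::field set \<Rightarrow> 'f set" where
  "fraction_field_in A = {a / b | a b. a \<in> A \<and> b \<in> A \<and> b \<noteq> 0}"

definition integral_over :: "'f::field set \<Rightarrow> 'f \<Rightarrow> bool" where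
  "integral_over A x \<longleftrightarrow>
     (\<exists>p. Polynomial.lead_coeff p = 1 \<and> (\<forall>i. Polynomial.coeff p i \<in> A) \<and> poly p x = 0)"

text \<open>As usual for domains, this means integrally closed in the field of fractions, not in \<open>'f\<close>.\<close>

definition integrally_closed :: "'f::field set \<Rightarrow> bool" where
  "integrally_closed A \<longleftrightarrow> (\<forall>x\<in>fraction_field_in A. integral_over A x \<longrightarrow> x \<in> A)"

definition integrally_closed_noetherian_subring :: "'f::field set \<Rightarrow> bool" where
  "integrally_closed_noetherian_subring A \<longleftrightarrow>
     subring A (ring_of_type_algebra :: 'f ring) \<and>
     noetherian_ring ((ring_of_type_algebra :: 'f ring)\<lparr>carrier := A\<rparr>) \<and>
     integrally_closed A"


section \<open>Lattices over subrings\<close>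

definition submodule_over :: "'f::field set \<Rightarrow> ('f ^ 'd) set \<Rightarrow> bool" where
  "submodule_over A L \<longleftrightarrow>
     0 \<in> L \<and> (\<forall>x\<in>L. \<forall>y\<in>L. x + y \<in> L) \<and> (\<forall>a\<in>A. \<forall>x\<in>L. a *s x \<in> L)"

definition finitely_generated_over :: "'f::field set \<Rightarrow> ('f ^ 'd) set \<Rightarrow> bool" where
  "finitely_generated_over A L \<longleftrightarrow>
     (\<exists>S. finite S \<and> S \<subseteq> L \<and> L = {\<Sum>x\<in>S. c x *s x | c. \<forall>x\<in>S. c x \<in> A})"

text \<open>
  \<open>F \<otimes>\<^sub>A L\<close> is the free abelian group on \<open>F \<times> L\<close> modulo biadditivity and \<open>A\<close>-balancedness, its
  elements being cosets. The natural map sends the class of \<open>(c, x)\<close> to \<open>c *s x\<close>. It is linear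
  over \<open>F\<close> (acting on the first factor), so it is an isomorphism iff it is bijective.
\<close>

definition tensor_relators ::
    "'f::field set \<Rightarrow> ('f ^ 'd) set \<Rightarrow> (('f \<times> ('f ^ 'd)) \<Rightarrow>\<^sub>0 int) set" where
  "tensor_relators A L =
     {frag_of (c + c', x) - frag_of (c, x) - frag_of (c', x) | c c' x. x \<in> L} \<union>
     {frag_of (c, x + y) - frag_of (c, x) - frag_of (c, y) | c x y. x \<in> L \<and> y \<in> L} \<union>
     {frag_of (c * a, x) - frag_of (c, a *s x) | c a x. a \<in> A \<and> x \<in> L}"

definition tensor_product ::
    "'f::field set \<Rightarrow> ('f ^ 'd) set \<Rightarrow> (('f \<times> ('f ^ 'd)) \<Rightarrow>\<^sub>0 int) set monoid" where
  "tensor_product A L =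
     free_Abelian_group (UNIV \<times> L) Mod
       generate (free_Abelian_group (UNIV \<times> L)) (tensor_relators A L)"

definition tensor_eval :: "(('f::field \<times> ('f ^ 'd)) \<Rightarrow>\<^sub>0 int) \<Rightarrow> 'f ^ 'd" where
  "tensor_eval t =
     (\<Sum>k\<in>Poly_Mapping.keys t. of_int (Poly_Mapping.lookup t k) *s (fst k *s snd k))"

definition tensor_natural_map :: "(('f::field \<times> ('f ^ 'd)) \<Rightarrow>\<^sub>0 int) set \<Rightarrow> 'f ^ 'd" where
  "tensor_natural_map K = the_elem (tensor_eval ` K)"

lemma tensor_eval_superset:
  assumes "finite T" "Poly_Mapping.keys t \<subseteq> T"
  shows "tensor_eval t = (\<Sum>k\<in>T. of_int (Poly_Mapping.lookup t k) *s (fst k *s snd k))"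
  unfolding tensor_eval_def
  by (rule sum.mono_neutral_left) (use assms in \<open>auto simp: in_keys_iff\<close>)

lemma tensor_eval_add: "tensor_eval (s + t) = tensor_eval s + tensor_eval t"
proof -
  let ?T = "Poly_Mapping.keys s \<union> Poly_Mapping.keys t"
  have "Poly_Mapping.keys (s + t) \<subseteq> ?T" by (rule keys_add)
  then show ?thesis
    by (simp add: tensor_eval_superset[of ?T] lookup_add vec.scale_left_distrib distrib_right flip: sum.distrib)
qed

lemma tensor_eval_uminus: "tensor_eval (- t) = - tensor_eval t"
proof -
  have "tensor_eval (- t) + tensor_eval t = tensor_eval 0"
    by (simp flip: tensor_eval_add)
  then show ?thesis by (simp add: tensor_eval_def eq_neg_iff_add_eq_0)
qed

lemma tensor_eval_diff: "tensor_eval (s - t) = tensor_eval s - tensor_eval t"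
  using tensor_eval_add[of s "- t"] by (simp add: tensor_eval_uminus)

lemma tensor_eval_frag_of: "tensor_eval (frag_of (c, x)) = c *s x"
  by (simp add: tensor_eval_def keys_frag_of)

lemma tensor_relators_subset:
  assumes "submodule_over A L" "r \<in> tensor_relators A L"
  shows "r \<in> carrier (free_Abelian_group (UNIV \<times> L))"
  using assms unfolding tensor_relators_def submodule_over_def
  by (auto simp: keys_frag_of dest!: subsetD[OF keys_diff])

lemma tensor_eval_relator: "r \<in> tensor_relators A L \<Longrightarrow> tensor_eval r = 0"
  unfolding tensor_relators_def
  by (auto simp: tensor_eval_diff tensor_eval_frag_of vec.scale_left_distrib vec.scale_right_distrib
      vector_smult_assoc)

lemma tensor_eval_relations:
  assumes "submodule_over A L"
    and "r \<in> generate (free_Abelian_group (UNIV \<times> L)) (tensor_relators A L)"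
  shows "tensor_eval r = 0"
  using assms(2)
proof (induction rule: generate.induct)
  case one
  then show ?case by (simp add: tensor_eval_def)
next
  case (incl h)
  then show ?case by (rule tensor_eval_relator)
next
  case (inv h)
  with tensor_relators_subset[OF assms(1)] show ?case
    by (auto simp: tensor_eval_uminus tensor_eval_relator)
next
  case (eng g h)
  then show ?case by (simp add: tensor_eval_add)
qed

text \<open>The natural map is well defined: it is evaluation on representatives.\<close>

lemma tensor_natural_map_coset:
  assumes "submodule_over A L"
  defines "G \<equiv> free_Abelian_group (UNIV \<times> L)"
  shows "tensor_natural_map (generate G (tensor_relators A L) #>\<^bsub>G\<^esub> t) = tensor_eval t"
proof -
  have "tensor_eval ` (generate G (tensor_relators A L) #>\<^bsub>G\<^esub> t) = {tensor_eval t}"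
    using generate.one[of G "tensor_relators A L"]
    unfolding r_coset_def G_def
    by (auto simp: tensor_eval_add tensor_eval_relations[OF assms(1)] image_UN)
  then show ?thesis by (simp add: tensor_natural_map_def)
qed

definition lattice_over :: "'f::field set \<Rightarrow> ('f ^ 'd) set \<Rightarrow> bool" where
  "lattice_over A L \<longleftrightarrow>
     submodule_over A L \<and> finitely_generated_over A L \<and>
     bij_betw tensor_natural_map (carrier (tensor_product A L)) UNIV"

definition definable_over :: "'f::field set \<Rightarrow> ('f ^ 'd ^ 'd) set \<Rightarrow> bool" where
  "definable_over A G \<longleftrightarrow> (\<exists>L. lattice_over A L \<and> (\<forall>g\<in>G. \<forall>x\<in>L. g *v x \<in> L))"

end

theory Submission
  imports Defs
begin

no_notation fps_nth (infixl \<open>$\<close> 75)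

text \<open>
  If a lattice is \<open>\<Gamma>\<close>-invariant, a cyclic product \<open>p\<close> is an eigenvalue, with an eigenvector in the
  lattice, of the product of the endomorphisms \<open>I - \<sigma>\<^sub>i\<close>; so \<open>p\<close> lies in the field of fractions \<open>K\<close> and
  some nonzero \<open>q\<close> has \<open>q * p\<^sup>m \<in> A\<close> for all \<open>m\<close>, which makes \<open>p\<close> integral over the Noetherian ring \<open>A\<close>.
  Conversely, the vectors \<open>c\<^bsub>i\<^sub>k i\<^sub>k\<^sub>-\<^sub>1\<^esub> \<cdots> c\<^bsub>i\<^sub>1 i\<^sub>0\<^esub> v\<^bsub>i\<^sub>k\<^esub>\<close> of paths starting at a fixed \<open>i\<^sub>0\<close> span an
  invariant \<open>A\<close>-module, generated by the simple paths; the functionals attached to the paths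
  ending at \<open>i\<^sub>0\<close> take values in \<open>A\<close> on it and embed it into \<open>A\<^sup>n\<^sup>+\<^sup>1\<close>.

  For \<open>\<Delta>\<close> of finite index with an invariant lattice, let \<open>\<sigma>\<close> be a reflection. By density
  \<open>{g \<in> \<Delta>. \<sigma> g \<sigma> \<in> \<Delta>}\<close> spans all matrices, so that in a lattice basis the products of any two entries
  of \<open>\<sigma>\<close> lie in \<open>K\<close>; as \<open>tr \<sigma> = n - 1 \<noteq> 0\<close>, the entries do too. Hence the sum of the finitely many
  \<open>\<Gamma>\<close>-translates of the lattice is again a lattice.
\<close>

section \<open>Linear algebra over subrings of a field\<close>

text \<open>Linear functionals are represented by vectors through this pairing, so that annihilators
  and Cartan entries become computations in coordinates.\<close>

definition vdot :: "'f::field ^ 'm \<Rightarrow> 'f ^ 'm \<Rightarrow> 'f" where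
  "vdot u x = (\<Sum>i\<in>UNIV. u $ i * x $ i)"

lemma vdot_simps [simp]:
  "vdot u 0 = 0" "vdot 0 x = 0"
  "vdot u (x + y) = vdot u x + vdot u y" "vdot u (x - y) = vdot u x - vdot u y"
  "vdot u (c *s x) = c * vdot u x" "vdot (c *s u) x = c * vdot u x"
  by (simp_all add: vdot_def algebra_simps sum.distrib sum_subtractf sum_distrib_left)

lemma vdot_sum: "vdot u (\<Sum>k\<in>S. f k) = (\<Sum>k\<in>S. vdot u (f k))"
  by (induction S rule: infinite_finite_induct) auto

lemma matrix_vector_mult_nth: "(M *v x) $ i = vdot (M $ i) x"
  by (simp add: matrix_vector_mult_def vdot_def)

lemma vdot_span:
  assumes "\<And>x. x \<in> S \<Longrightarrow> vdot u x = 0" "y \<in> vec.span S"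
  shows "vdot u y = 0"
  using assms(2)
  by (rule vec.span_induct) (auto simp: vec.subspace_def assms(1))

text \<open>A maximal independent subset \<open>B\<close> of \<open>S\<close> has at most
  \<open>CARD('m)\<close> elements and fits into the rows of a square matrix. A kernel vector of
  that matrix would annihilate \<open>S\<close>, so the determinant is nonzero; then no row can be
  padding, and every row comes from \<open>S\<close>.\<close>

lemma exists_basis_in:
  fixes S :: "('f::field ^ 'm) set"
  assumes "\<And>u. (\<And>x. x \<in> S \<Longrightarrow> vdot u x = 0) \<Longrightarrow> u = 0"
  obtains b :: "'m \<Rightarrow> 'f ^ 'm" where "\<And>i. b i \<in> S" "det (\<chi> i. b i) \<noteq> 0"
proof -
  obtain B where B: "B \<subseteq> S" "vec.independent B" "S \<subseteq> vec.span B"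
    using vec.maximal_independent_subset[of S] by blast
  then have fin: "finite B" and "card B \<le> vec.dim B"
    using vec.independent_bound_general by blast+
  then have "card B \<le> CARD('m)"
    using vec.dim_subset_UNIV[of B] by (simp add: vec.dimension_def card_cart_basis)
  then obtain f :: "'f ^ 'm \<Rightarrow> 'm" where f: "inj_on f B"
    using card_le_inj[OF fin, of "UNIV :: 'm set"] by auto
  \<comment> \<open>Rows that receive no element of \<open>B\<close> are filled with 0; the nonzero
    determinant excludes them below.\<close>
  define b where "b i = (if i \<in> f ` B then inv_into B f i else 0)" for i
  have bB: "x \<in> range b" if "x \<in> B" for x
  proof -
    have "b (f x) = x" using that f by (simp add: b_def)
    then show ?thesis by (metis rangeI)
  qed
  have det: "det (\<chi> i. b i) \<noteq> 0"
  proof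
    assume "det (\<chi> i. b i) = 0"
    then have "\<not> invertible (\<chi> i. b i)" by (simp add: invertible_det_nz)
    then obtain u where u: "u \<noteq> 0" "(\<chi> i. b i) *v u = 0"
      by (metis invertible_left_inverse matrix_left_invertible_ker)
    have "vdot (b i) u = 0" for i
      using arg_cong[OF u(2), of "\<lambda>v. v $ i"] by (simp add: matrix_vector_mult_nth)
    then have "vdot u x = 0" if "x \<in> B" for x
      using bB[OF that] by (auto simp: vdot_def mult.commute)
    then have "vdot u x = 0" if "x \<in> S" for x
      using vdot_span[of B u x] that B(3) by blast
    then show False using assms u(1) by blast
  qed
  have "b i \<in> S" for i
  proof -
    have "i \<in> f ` B"
    proof (rule ccontr)
      assume "i \<notin> f ` B"
      then have "row i (\<chi> i. b i) = 0" by (simp add: row_def b_def vec_eq_iff)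
      then have "\<not> invertible (\<chi> i. b i)"
        using det_zero_row(2)[of i "\<chi> i. b i"] by (simp add: invertible_det_nz)
      then show False using det by (simp add: invertible_det_nz)
    qed
    then show ?thesis using B(1) by (auto simp: b_def inv_into_into)
  qed
  then show ?thesis using det that by blast
qed

locale subring_of_field =
  fixes A :: "'f::field set"
  assumes zero [simp]: "0 \<in> A" and one [simp]: "1 \<in> A"
    and add: "x \<in> A \<Longrightarrow> y \<in> A \<Longrightarrow> x + y \<in> A"
    and mult: "x \<in> A \<Longrightarrow> y \<in> A \<Longrightarrow> x * y \<in> A"
    and uminus: "x \<in> A \<Longrightarrow> - x \<in> A"
begin

lemma diff: "x \<in> A \<Longrightarrow> y \<in> A \<Longrightarrow> x - y \<in> A"
  using add[of x "- y"] uminus[of y] by simp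

lemma sum: "(\<And>k. k \<in> S \<Longrightarrow> f k \<in> A) \<Longrightarrow> sum f S \<in> A"
  by (induction S rule: infinite_finite_induct) (auto intro: add)

lemma prod: "(\<And>k. k \<in> S \<Longrightarrow> f k \<in> A) \<Longrightarrow> prod f S \<in> A"
  by (induction S rule: infinite_finite_induct) (auto intro: mult)

lemma of_nat: "of_nat m \<in> A"
  by (induction m) (auto intro: add)

lemma vdot: "(\<And>i. u $ i \<in> A) \<Longrightarrow> (\<And>i. x $ i \<in> A) \<Longrightarrow> vdot u x \<in> A"
  unfolding vdot_def by (intro sum mult)

lemma det: "(\<And>i j. M $ i $ j \<in> A) \<Longrightarrow> det M \<in> A"
  unfolding det_def
  by (intro sum mult prod) (auto simp: sign_def uminus)

end

locale subfield_of_field = subring_of_field +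
  assumes inverse: "x \<in> A \<Longrightarrow> inverse x \<in> A"
begin

lemma divide: "x \<in> A \<Longrightarrow> y \<in> A \<Longrightarrow> x / y \<in> A"
  by (simp add: divide_inverse mult inverse)

text \<open>Cramer's rule expresses the solution by determinants over the subfield, so a solution
  found in the large field already has its coordinates in the subfield.\<close>

lemma linear_system:
  assumes "det M \<noteq> 0" "\<And>i j. M $ i $ j \<in> A" "\<And>i. (M *v x) $ i \<in> A"
  shows "x $ k \<in> A"
proof -
  have "x = (\<chi> k. Determinants.det (\<chi> i j. if j = k then (M *v x) $ i else M $ i $ j) / Determinants.det M)"
    using cramer[OF assms(1), of x "M *v x"] by blast
  then have "x $ k = Determinants.det (\<chi> i j. if j = k then (M *v x) $ i else M $ i $ j) / Determinants.det M"
    by (simp add: vec_eq_iff)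
  also have "\<dots> \<in> A"
    by (intro divide det) (auto simp: assms)
  finally show ?thesis .
qed

end

section \<open>Density\<close>

lemma polyfun_sum:
  "(\<And>k. k \<in> S \<Longrightarrow> f k \<in> matrix_polyfun) \<Longrightarrow> (\<lambda>M. \<Sum>k\<in>S. f k M) \<in> matrix_polyfun"
  by (induction S rule: infinite_finite_induct) (auto intro: matrix_polyfun.intros)

lemma polyfun_prod:
  "(\<And>k. k \<in> S \<Longrightarrow> f k \<in> matrix_polyfun) \<Longrightarrow> (\<lambda>M. \<Prod>k\<in>S. f k M) \<in> matrix_polyfun"
  by (induction S rule: infinite_finite_induct) (auto intro: matrix_polyfun.intros)

lemma polyfun_trace: "(\<lambda>M. trace (c ** M)) \<in> matrix_polyfun"
  unfolding trace_def matrix_matrix_mult_def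
  by (simp, intro polyfun_sum matrix_polyfun.intros)

lemma trace_smult: "trace (\<chi> i. c *s M $ i) = (c::'f::field) * trace M"
  by (simp add: trace_def sum_distrib_left)

lemma mult_smult: "D ** (\<chi> i. c *s M $ i) = (\<chi> i. (c::'f::field) *s (D ** M) $ i)"
  by (simp add: matrix_matrix_mult_def vec_eq_iff sum_distrib_left mult_ac)

lemma det_line_poly:
  fixes M N :: "'f::field ^ 'd ^ 'd"
  shows "\<exists>p. \<forall>t. poly p t = det (M + (\<chi> i. t *s N $ i))"
proof -
  let ?p = "\<Sum>\<pi>\<in>{\<pi>. \<pi> permutes (UNIV::'d set)}. Polynomial.smult (of_int (sign \<pi>))
     (\<Prod>i\<in>UNIV. [: M $ i $ \<pi> i, N $ i $ \<pi> i :])"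
  have "poly ?p t = det (M + (\<chi> i. t *s N $ i))" for t
    by (simp add: det_def poly_sum poly_prod)
  then show ?thesis by blast
qed

text \<open>Induction on \<open>D\<close>: a matrix that works for \<open>D\<close> is moved along a
  line whose direction \<open>N\<close> pairs nontrivially with the new element. Each condition
  becomes a nonzero polynomial in the parameter, and an infinite field has a point where none of
  them vanishes.\<close>

lemma exists_matrix_avoiding:
  fixes D :: "('f::field_char_0 ^ 'd ^ 'd) set"
  assumes "finite D" "0 \<notin> D"
  shows "\<exists>M. det M \<noteq> 0 \<and> (\<forall>d\<in>D. trace (d ** M) \<noteq> 0)"
  using assms
proof (induction D)
  case empty
  then show ?case by (auto intro!: exI[of _ "mat 1"])
next
  case (insert d D)
  then obtain M where M: "det M \<noteq> 0" "\<forall>d\<in>D. trace (d ** M) \<noteq> 0" by auto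
  obtain k l where kl: "d $ k $ l \<noteq> 0" using insert.prems by (auto simp: vec_eq_iff)
  \<comment> \<open>The unit sits at the transposed position, so that the trace pairing with
    \<open>d\<close> picks out the entry \<open>d $ k $ l\<close>.\<close>
  define N :: "'f ^ 'd ^ 'd" where "N = (\<chi> i j. if i = l \<and> j = k then 1 else 0)"
  have "trace (d ** N) = (\<Sum>i\<in>UNIV. \<Sum>j\<in>UNIV. if i = k \<and> j = l then d $ i $ j else 0)"
    by (auto simp: trace_def matrix_matrix_mult_def N_def intro!: sum.cong)
  also have "\<dots> = (\<Sum>i\<in>UNIV. if i = k then d $ i $ l else 0)"
    by (intro sum.cong) (auto simp: sum.delta)
  also have "\<dots> = d $ k $ l" by simp
  finally have dN: "trace (d ** N) \<noteq> 0" using kl by simp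
  obtain p where p: "\<And>t. poly p t = det (M + (\<chi> i. t *s N $ i))"
    using det_line_poly by blast
  define q where "q e = [: trace (e ** M), trace (e ** N) :]" for e
  have q: "poly (q e) t = trace (e ** (M + (\<chi> i. t *s N $ i)))" for e t
    by (simp add: q_def matrix_add_ldistrib trace_add mult_smult trace_smult)
  have "poly p 0 = det M" unfolding p by (rule arg_cong[of _ _ det]) (simp add: vec_eq_iff)
  then have "p \<noteq> 0" using M by auto
  moreover have "q e \<noteq> 0" if "e \<in> insert d D" for e
    using that M dN by (auto simp: q_def)
  ultimately have "p * (\<Prod>e\<in>insert d D. q e) \<noteq> 0"
    using insert.hyps by (auto simp: prod_zero_iff)
  then obtain t where "poly (p * (\<Prod>e\<in>insert d D. q e)) t \<noteq> 0"
    using poly_all_0_iff_0 by blast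
  then have "poly p t \<noteq> 0 \<and> (\<forall>e\<in>insert d D. poly (q e) t \<noteq> 0)"
    using insert.hyps by (auto simp: poly_prod prod_zero_iff)
  then show ?case unfolding p q by blast
qed

text \<open>Algebraic closedness gives a root \<open>s\<close> by which the matrix can be rescaled
  to determinant 1; the traces are only multiplied by the nonzero \<open>s\<close>.\<close>

lemma exists_det_one_avoiding:
  fixes D :: "('f::{alg_closed_field, field_char_0} ^ 'd ^ 'd) set"
  assumes "finite D" "0 \<notin> D"
  shows "\<exists>M. det M = 1 \<and> (\<forall>d\<in>D. trace (d ** M) \<noteq> 0)"
proof -
  obtain M where M: "det M \<noteq> 0" "\<forall>d\<in>D. trace (d ** M) \<noteq> 0"
    using exists_matrix_avoiding[OF assms] by blast
  obtain s where s: "s ^ CARD('d) = inverse (det M)"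
    using nth_root_exists[of "CARD('d)" "inverse (det M)"] by auto
  have "det (\<chi> i. s *s M $ i) = 1"
    using M(1) s by (simp add: det_rows_mul)
  moreover have "s \<noteq> 0" using s M(1) by (auto simp: power_0_left)
  ultimately show ?thesis using M(2)
    by (intro exI[of _ "\<chi> i. s *s M $ i"]) (auto simp: mult_smult trace_smult)
qed

text \<open>
  Since \<open>\<Gamma>\<close> is covered by finitely many translates of \<open>H\<close>, a linear form vanishing on \<open>H\<close> yields a
  product of linear forms vanishing on \<open>\<Gamma>\<close> and hence on \<open>SL\<^sup>\<plusminus>\<close>.
\<close>

lemma dense_no_linear_form:
  fixes \<Gamma> H R :: "('f::{alg_closed_field, field_char_0} ^ 'd ^ 'd) set"
  assumes "zariski_dense_in_SLpm \<Gamma>" "finite R" "\<And>r. r \<in> R \<Longrightarrow> invertible r"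
    and cover: "\<And>g. g \<in> \<Gamma> \<Longrightarrow> \<exists>r\<in>R. g ** r \<in> H"
    and c: "\<And>h. h \<in> H \<Longrightarrow> trace (c ** h) = 0"
  shows "c = 0"
proof (rule ccontr)
  assume "c \<noteq> 0"
  have "r ** c \<noteq> 0" if "r \<in> R" for r
  proof
    assume "r ** c = 0"
    moreover obtain s where "s ** r = mat 1" using assms(3)[OF \<open>r \<in> R\<close>] by (auto simp: invertible_def)
    ultimately have "mat 1 ** c = 0"
      by (metis matrix_mul_assoc times0_right)
    then show False using \<open>c \<noteq> 0\<close> by simp
  qed
  then have "0 \<notin> (\<lambda>r. r ** c) ` R" by force
  then obtain M where M: "det M = 1" "\<forall>d\<in>(\<lambda>r. r ** c) ` R. trace (d ** M) \<noteq> 0"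
    using exists_det_one_avoiding[of "(\<lambda>r. r ** c) ` R"] assms(2) by auto
  let ?P = "\<lambda>M. \<Prod>r\<in>R. trace ((r ** c) ** M)"
  have "?P \<in> matrix_polyfun" by (intro polyfun_prod polyfun_trace)
  then have "zariski_closed {M. ?P M = 0}"
    unfolding zariski_closed_def by (intro exI[of _ "{?P}"]) auto
  moreover have "\<Gamma> \<subseteq> {M. ?P M = 0}"
  proof
    fix g assume "g \<in> \<Gamma>"
    then obtain r where r: "r \<in> R" "g ** r \<in> H" using cover by blast
    \<comment> \<open>Cyclicity of the trace turns a form evaluated at the translate
      \<open>g ** r\<close> into one evaluated at \<open>g\<close>; this is why the factors of
      \<open>?P\<close> use \<open>r ** c\<close>.\<close>
    have "trace ((r ** c) ** g) = trace (c ** (g ** r))"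
      by (metis matrix_mul_assoc trace_mul_sym)
    then have "trace ((r ** c) ** g) = 0" using c r by simp
    then show "g \<in> {M. ?P M = 0}" using r assms(2) by (auto simp: prod_zero_iff)
  qed
  ultimately have "carrier SLpm \<subseteq> {M. ?P M = 0}"
    using assms(1) unfolding zariski_dense_in_SLpm_def by blast
  moreover have "M \<in> carrier SLpm" using M by (simp add: SLpm_def)
  ultimately have "?P M = 0" by blast
  then show False using M(2) assms(2) by (auto simp: prod_zero_iff)
qed

section \<open>Fields of fractions and common denominators\<close>

lemma subring_of_fieldI:
  assumes "subring A (ring_of_type_algebra :: 'f::field ring)"
  shows "subring_of_field A"
proof -
  interpret field "ring_of_type_algebra :: 'f ring" by (rule field_from_type_algebra)
  note simps = ring_of_type_algebra_def
  have um: "\<ominus>\<^bsub>ring_of_type_algebra\<^esub> x = - x" for x :: 'f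
    by (rule minus_equality) (simp_all add: simps)
  show ?thesis
    using subringE[OF assms] um by unfold_locales (auto simp: simps)
qed

context subring_of_field
begin

lemma fraction_subset: "x \<in> A \<Longrightarrow> x \<in> fraction_field_in A"
  unfolding fraction_field_in_def using one by (force intro: exI[of _ x] exI[of _ 1])

lemma subfield_fraction_field: "subfield_of_field (fraction_field_in A)"
proof
  show "0 \<in> fraction_field_in A" "1 \<in> fraction_field_in A"
    by (simp_all add: fraction_subset)
next
  fix x y assume "x \<in> fraction_field_in A" "y \<in> fraction_field_in A"
  then obtain a b c d where x: "x = a / b" "a \<in> A" "b \<in> A" "b \<noteq> 0"
    and y: "y = c / d" "c \<in> A" "d \<in> A" "d \<noteq> 0"
    by (auto simp: fraction_field_in_def)
  have "x + y = (a * d + c * b) / (b * d)" "x * y = (a * c) / (b * d)"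
    using x y by (auto simp: field_simps)
  moreover have "a * d + c * b \<in> A" "b * d \<in> A" "a * c \<in> A" "b * d \<noteq> 0"
    using x y by (auto intro!: add mult)
  ultimately show "x + y \<in> fraction_field_in A" "x * y \<in> fraction_field_in A"
    unfolding fraction_field_in_def by blast+
next
  fix x assume "x \<in> fraction_field_in A"
  then obtain a b where x: "x = a / b" "a \<in> A" "b \<in> A" "b \<noteq> 0"
    by (auto simp: fraction_field_in_def)
  have "- x = (- a) / b" using x by simp
  then show "- x \<in> fraction_field_in A"
    unfolding fraction_field_in_def using x uminus by blast
  show "inverse x \<in> fraction_field_in A"
  proof (cases "a = 0")
    case True
    then show ?thesis using x by (simp add: fraction_subset)
  next
    case False
    then have "inverse x = b / a" using x by simp
    then show ?thesis unfolding fraction_field_in_def using x False by blast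
  qed
qed

lemma common_denominator:
  assumes "finite S" "\<And>s. s \<in> S \<Longrightarrow> f s \<in> fraction_field_in A"
  shows "\<exists>d\<in>A. d \<noteq> 0 \<and> (\<forall>s\<in>S. d * f s \<in> A)"
  using assms
proof (induction S)
  case empty
  then show ?case by (intro bexI[of _ 1]) auto
next
  case (insert s S)
  then obtain d where d: "d \<in> A" "d \<noteq> 0" "\<forall>s\<in>S. d * f s \<in> A" by auto
  obtain a b where ab: "f s = a / b" "a \<in> A" "b \<in> A" "b \<noteq> 0"
    using insert.prems[of s] by (auto simp: fraction_field_in_def)
  have "b * d * f r \<in> A" if "r \<in> insert s S" for r
  proof (cases "r = s")
    case True
    then show ?thesis using ab d by (simp add: mult)
  next
    case False
    then show ?thesis using ab d that mult[of b "d * f r"] by (simp add: mult.assoc)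
  qed
  then show ?case using ab d by (intro bexI[of _ "b * d"]) (auto intro: mult)
qed

end

section \<open>Lattices\<close>

text \<open>The additive extension of \<open>f\<close> from the generators to the free abelian
  group. It is the scalar counterpart of \<open>tensor_eval\<close> and serves to define functionals
  on the tensor product.\<close>

definition free_eval :: "('x \<Rightarrow> 'f::field) \<Rightarrow> ('x \<Rightarrow>\<^sub>0 int) \<Rightarrow> 'f" where
  "free_eval f t = (\<Sum>k\<in>Poly_Mapping.keys t. of_int (Poly_Mapping.lookup t k) * f k)"

lemma free_eval_superset:
  assumes "finite T" "Poly_Mapping.keys t \<subseteq> T"
  shows "free_eval f t = (\<Sum>k\<in>T. of_int (Poly_Mapping.lookup t k) * f k)"
  unfolding free_eval_def
  by (rule sum.mono_neutral_left) (use assms in \<open>auto simp: in_keys_iff\<close>)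

lemma free_eval_0 [simp]: "free_eval f 0 = 0"
  by (simp add: free_eval_def)

lemma free_eval_add: "free_eval f (s + t) = free_eval f s + free_eval f t"
proof -
  let ?T = "Poly_Mapping.keys s \<union> Poly_Mapping.keys t"
  have "Poly_Mapping.keys (s + t) \<subseteq> ?T" by (rule keys_add)
  then show ?thesis
    by (simp add: free_eval_superset[of ?T] lookup_add distrib_right flip: sum.distrib)
qed

lemma free_eval_uminus: "free_eval f (- t) = - free_eval f t"
  using free_eval_add[of f "- t" t] by (simp add: eq_neg_iff_add_eq_0)

lemma free_eval_diff: "free_eval f (s - t) = free_eval f s - free_eval f t"
  using free_eval_add[of f s "- t"] by (simp add: free_eval_uminus)

lemma free_eval_frag_of [simp]: "free_eval f (frag_of k) = f k"
  by (simp add: free_eval_def keys_frag_of)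

lemma free_eval_sum: "free_eval f (\<Sum>i\<in>S. t i) = (\<Sum>i\<in>S. free_eval f (t i))"
  by (induction S rule: infinite_finite_induct) (auto simp: free_eval_add)

lemma tensor_eval_0 [simp]: "tensor_eval 0 = 0"
  by (simp add: tensor_eval_def)

lemma tensor_eval_sum: "tensor_eval (\<Sum>i\<in>S. t i) = (\<Sum>i\<in>S. tensor_eval (t i))"
  by (induction S rule: infinite_finite_induct) (auto simp: tensor_eval_add)

definition tensor_relations ::
    "'f::field set \<Rightarrow> ('f ^ 'd) set \<Rightarrow> (('f \<times> ('f ^ 'd)) \<Rightarrow>\<^sub>0 int) set" where
  "tensor_relations A L = generate (free_Abelian_group (UNIV \<times> L)) (tensor_relators A L)"

lemma subgroup_tensor_relations:
  assumes "submodule_over A L"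
  shows "subgroup (tensor_relations A L) (free_Abelian_group (UNIV \<times> L))"
  unfolding tensor_relations_def
  using tensor_relators_subset[OF assms]
  by (intro group.generate_is_subgroup) (auto simp del: carrier_free_Abelian_group_iff)

lemma tensor_relations_closed:
  assumes "submodule_over A L"
  shows "0 \<in> tensor_relations A L"
    and "r \<in> tensor_relations A L \<Longrightarrow> s \<in> tensor_relations A L \<Longrightarrow> r + s \<in> tensor_relations A L"
    and "r \<in> tensor_relations A L \<Longrightarrow> - r \<in> tensor_relations A L"
    and "r \<in> tensor_relations A L \<Longrightarrow> s \<in> tensor_relations A L \<Longrightarrow> r - s \<in> tensor_relations A L"
proof -
  note sg = subgroup_tensor_relations[OF assms]
  show 0: "0 \<in> tensor_relations A L" using subgroup.one_closed[OF sg] by simp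
  show a: "r + s \<in> tensor_relations A L"
    if "r \<in> tensor_relations A L" "s \<in> tensor_relations A L" for r s
    using subgroup.m_closed[OF sg that] by simp
  show m: "- r \<in> tensor_relations A L" if "r \<in> tensor_relations A L" for r
    using subgroup.m_inv_closed[OF sg that] subgroup.mem_carrier[OF sg that] by simp
  show "r - s \<in> tensor_relations A L"
    if "r \<in> tensor_relations A L" "s \<in> tensor_relations A L" for r s
    using a[OF that(1) m[OF that(2)]] by simp
qed

lemma tensor_relations_sum:
  assumes "submodule_over A L" "\<And>i. i \<in> S \<Longrightarrow> f i \<in> tensor_relations A L"
  shows "sum f S \<in> tensor_relations A L"
  using assms(2)
  by (induction S rule: infinite_finite_induct) (auto intro: tensor_relations_closed[OF assms(1)])

text \<open>A map \<open>\<phi>\<close> that is \<open>A\<close>-linear on \<open>L\<close> induces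
  a functional on the tensor product, sending \<open>c \<otimes> x\<close> to
  \<open>c * \<phi> x\<close>: it is enough that the three kinds of relators are sent to 0.\<close>

lemma free_eval_relations:
  assumes "submodule_over A L" "r \<in> tensor_relations A L"
    and add: "\<And>x y. x \<in> L \<Longrightarrow> y \<in> L \<Longrightarrow> \<phi> (x + y) = \<phi> x + \<phi> y"
    and scale: "\<And>a x. a \<in> A \<Longrightarrow> x \<in> L \<Longrightarrow> \<phi> (a *s x) = a * \<phi> x"
  shows "free_eval (\<lambda>(c, x). c * \<phi> x) r = 0"
  using assms(2) unfolding tensor_relations_def
proof (induction rule: generate.induct)
  case one
  then show ?case by simp
next
  case (incl h)
  then show ?case
    unfolding tensor_relators_def by (auto simp: free_eval_diff add scale distrib_left distrib_right mult.assoc)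
next
  case (inv h)
  then have "free_eval (\<lambda>(c, x). c * \<phi> x) h = 0"
    unfolding tensor_relators_def by (auto simp: free_eval_diff add scale distrib_left distrib_right mult.assoc)
  with inv tensor_relators_subset[OF assms(1)] show ?case
    by (auto simp: free_eval_uminus)
next
  case (eng g h)
  then show ?case by (simp add: free_eval_add)
qed

lemma tensor_carrier:
  "carrier (tensor_product A L) =
     (\<lambda>t. tensor_relations A L #>\<^bsub>free_Abelian_group (UNIV \<times> L)\<^esub> t) ` {t. Poly_Mapping.keys t \<subseteq> UNIV \<times> L}"
  by (auto simp: tensor_product_def FactGroup_def RCOSETS_def tensor_relations_def)

lemma tensor_coset: "tensor_relations A L #>\<^bsub>free_Abelian_group (UNIV \<times> L)\<^esub> t = (\<lambda>r. r + t) ` tensor_relations A L"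
  by (auto simp: r_coset_def)

text \<open>Two representatives give the same coset exactly when their difference is a relation.
  Injectivity therefore means that the kernel of evaluation consists of relations, and later
  arguments can work with representatives.\<close>

lemma bij_natural_map_iff:
  assumes "submodule_over A L"
  shows "bij_betw tensor_natural_map (carrier (tensor_product A L)) UNIV \<longleftrightarrow>
    (\<forall>t. Poly_Mapping.keys t \<subseteq> UNIV \<times> L \<longrightarrow> tensor_eval t = 0 \<longrightarrow> t \<in> tensor_relations A L) \<and>
    (\<forall>v. \<exists>t. Poly_Mapping.keys t \<subseteq> UNIV \<times> L \<and> tensor_eval t = v)"
    (is "?bij \<longleftrightarrow> ?inj \<and> ?surj")
proof -
  let ?c = "\<lambda>t. (\<lambda>r. r + t) ` tensor_relations A L"
  let ?T = "{t :: ('a \<times> ('a ^ 'b)) \<Rightarrow>\<^sub>0 int. Poly_Mapping.keys t \<subseteq> UNIV \<times> L}"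
  note closed = tensor_relations_closed[OF assms]
  have nat: "tensor_natural_map (?c t) = tensor_eval t" for t
    using tensor_natural_map_coset[OF assms, of t]
    by (simp add: tensor_coset flip: tensor_relations_def)
  have eq: "?c s = ?c t \<longleftrightarrow> s - t \<in> tensor_relations A L" for s t
  proof
    assume "?c s = ?c t"
    moreover have "s \<in> ?c s" using closed(1) by force
    ultimately show "s - t \<in> tensor_relations A L" by auto
  next
    assume st: "s - t \<in> tensor_relations A L"
    have "r + s \<in> ?c t" if "r \<in> tensor_relations A L" for r
      using closed(2)[OF that st] by (auto simp: image_iff intro!: bexI[of _ "r + (s - t)"])
    moreover have "r + t \<in> ?c s" if "r \<in> tensor_relations A L" for r
      using closed(4)[OF that st] by (auto simp: image_iff intro!: bexI[of _ "r - (s - t)"])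
    ultimately show "?c s = ?c t" by blast
  qed
  have diffT: "s - t \<in> ?T" if "s \<in> ?T" "t \<in> ?T" for s t
    using that keys_diff[of s t] by blast
  have "inj_on tensor_natural_map (?c ` ?T) \<longleftrightarrow> ?inj"
  proof
    assume inj: "inj_on tensor_natural_map (?c ` ?T)"
    show ?inj
    proof (intro allI impI)
      fix t assume t: "Poly_Mapping.keys t \<subseteq> UNIV \<times> L" "tensor_eval t = 0"
      then have "tensor_natural_map (?c t) = tensor_natural_map (?c 0)"
        unfolding nat by simp
      moreover have "?c t \<in> ?c ` ?T" "?c 0 \<in> ?c ` ?T" using t(1) by (auto simp del: add_0_right)
      ultimately have "?c t = ?c 0" by (rule inj_onD[OF inj])
      then show "t \<in> tensor_relations A L" using eq[of t 0] by simp
    qed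
  next
    assume inj: ?inj
    show "inj_on tensor_natural_map (?c ` ?T)"
    proof (rule inj_onI)
      fix U W assume "U \<in> ?c ` ?T" "W \<in> ?c ` ?T" and e: "tensor_natural_map U = tensor_natural_map W"
      then obtain s t where st: "U = ?c s" "W = ?c t" "s \<in> ?T" "t \<in> ?T" by blast
      then have "tensor_eval (s - t) = 0" using e by (simp add: nat tensor_eval_diff)
      then have "s - t \<in> tensor_relations A L" using inj diffT[OF st(3,4)] by blast
      then show "U = W" using eq st by blast
    qed
  qed
  moreover have "tensor_natural_map ` ?c ` ?T = UNIV \<longleftrightarrow> ?surj"
  proof -
    have "tensor_natural_map ` ?c ` ?T = tensor_eval ` ?T"
      unfolding image_image nat ..
    then show ?thesis by (auto simp: set_eq_iff image_iff) (metis+)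
  qed
  ultimately show ?thesis
    by (simp add: bij_betw_def tensor_carrier tensor_coset)
qed

section \<open>Spans and independence over subrings\<close>

definition span_over :: "'f::field set \<Rightarrow> ('f ^ 'd) set \<Rightarrow> ('f ^ 'd) set" where
  "span_over A S = {\<Sum>x\<in>S. c x *s x | c. \<forall>x\<in>S. c x \<in> A}"

lemma span_overE:
  assumes "x \<in> span_over A S"
  obtains c where "\<forall>s\<in>S. c s \<in> A" "x = (\<Sum>s\<in>S. c s *s s)"
  using assms by (auto simp: span_over_def)

lemma span_overI: "\<forall>s\<in>S. c s \<in> A \<Longrightarrow> x = (\<Sum>s\<in>S. c s *s s) \<Longrightarrow> x \<in> span_over A S"
  by (auto simp: span_over_def)

lemma submodule_sum:
  assumes "submodule_over A L" "\<And>i. i \<in> S \<Longrightarrow> f i \<in> L"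
  shows "sum f S \<in> L"
  using assms(2)
  by (induction S rule: infinite_finite_induct) (use assms(1) in \<open>auto simp: submodule_over_def\<close>)

lemma span_over_least:
  assumes "submodule_over A L" "S \<subseteq> L"
  shows "span_over A S \<subseteq> L"
proof
  fix x assume "x \<in> span_over A S"
  then obtain c where c: "\<forall>s\<in>S. c s \<in> A" "x = (\<Sum>s\<in>S. c s *s s)" by (rule span_overE)
  then show "x \<in> L"
    using assms by (auto simp: submodule_over_def intro!: submodule_sum[OF assms(1)])
qed

lemma finitely_generated_over_iff:
  "finitely_generated_over A L \<longleftrightarrow> (\<exists>S. finite S \<and> S \<subseteq> L \<and> L = span_over A S)"
  by (simp add: finitely_generated_over_def span_over_def)

context subring_of_field
begin

lemma submodule_span_over: "submodule_over A (span_over A S)"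
  unfolding submodule_over_def
proof (intro conjI ballI)
  show "0 \<in> span_over A S" by (auto simp: span_over_def intro!: exI[of _ "\<lambda>_. 0"])
  fix x y assume "x \<in> span_over A S" and y: "y \<in> span_over A S"
  then obtain c where c: "\<forall>s\<in>S. c s \<in> A" "x = (\<Sum>s\<in>S. c s *s s)" by (elim span_overE)
  obtain d where "\<forall>s\<in>S. d s \<in> A" "y = (\<Sum>s\<in>S. d s *s s)" using y by (rule span_overE)
  with c have "\<forall>s\<in>S. c s + d s \<in> A" "x + y = (\<Sum>s\<in>S. (c s + d s) *s s)"
    by (simp_all add: vec.scale_left_distrib sum.distrib add)
  then show "x + y \<in> span_over A S" by (rule span_overI)
next
  fix a x assume "a \<in> A" "x \<in> span_over A S"
  then obtain c where "\<forall>s\<in>S. c s \<in> A" "x = (\<Sum>s\<in>S. c s *s s)"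
    by (elim span_overE)
  then have "\<forall>s\<in>S. a * c s \<in> A" "a *s x = (\<Sum>s\<in>S. (a * c s) *s s)"
    using \<open>a \<in> A\<close> by (simp_all add: vec.scale_sum_right mult)
  then show "a *s x \<in> span_over A S" by (rule span_overI)
qed

lemma span_over_base:
  assumes "finite S" "x \<in> S"
  shows "x \<in> span_over A S"
proof -
  have "(\<Sum>s\<in>S. (if s = x then 1 else 0) *s s) = (\<Sum>s\<in>S. if s = x then s else 0)"
    by (intro sum.cong) auto
  also have "\<dots> = x" using assms by simp
  finally show ?thesis
    by (auto simp: span_over_def intro!: exI[of _ "\<lambda>s. if s = x then 1 else 0"])
qed

lemma finitely_generated_span_over: "finite S \<Longrightarrow> finitely_generated_over A (span_over A S)"
  unfolding finitely_generated_over_iff using span_over_base by blast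

end

text \<open>Only coefficients from \<open>K\<close> are tested, which may be weaker than
  independence over the whole field; closing this gap is what injectivity of the natural map is used
  for.\<close>

definition independent_over :: "'f::field set \<Rightarrow> ('f ^ 'd) set \<Rightarrow> bool" where
  "independent_over K B \<longleftrightarrow>
     (\<forall>k. (\<forall>b\<in>B. k b \<in> K) \<and> (\<Sum>b\<in>B. k b *s b) = 0 \<longrightarrow> (\<forall>b\<in>B. k b = 0))"

lemma (in subring_of_field) independent_over_unique:
  assumes "independent_over A B" "\<And>b. b \<in> B \<Longrightarrow> k b \<in> A" "\<And>b. b \<in> B \<Longrightarrow> l b \<in> A"
    and "(\<Sum>b\<in>B. k b *s b) = (\<Sum>b\<in>B. l b *s b)" "b \<in> B"
  shows "k b = l b"
proof -
  have "(\<Sum>b\<in>B. (k b - l b) *s b) = 0"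
    using assms(4) by (simp add: vec.scale_left_diff_distrib sum_subtractf)
  moreover have "\<forall>b\<in>B. k b - l b \<in> A" using assms(2,3) by (auto intro: diff)
  ultimately have "k b - l b = 0"
    using assms(1,5) unfolding independent_over_def
    by (elim allE[of _ "\<lambda>b. k b - l b"]) blast
  then show ?thesis by simp
qed

text \<open>A generator outside a maximal independent subset occurs in a relation with a nonzero
  coefficient, which can be inverted in the subfield.\<close>

lemma (in subfield_of_field) exists_independent_over_spanning:
  assumes "finite S"
  shows "\<exists>B\<subseteq>S. independent_over A B \<and> S \<subseteq> span_over A B"
proof -
  let ?X = "{B. B \<subseteq> S \<and> independent_over A B}"
  have "finite ?X" using assms by simp
  moreover have "{} \<in> ?X" by (simp add: independent_over_def)
  ultimately obtain B where "B \<in> ?X" and max': "\<forall>B'\<in>?X. B \<subseteq> B' \<longrightarrow> B = B'"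
    using finite_has_maximal[of ?X] by blast
  then have B: "B \<subseteq> S" "independent_over A B" by auto
  have max: "B = B'" if "B' \<subseteq> S" "independent_over A B'" "B \<subseteq> B'" for B'
    using max' that by blast
  have fin: "finite B" using B assms finite_subset by blast
  have "x \<in> span_over A B" if "x \<in> S" for x
  proof (cases "x \<in> B")
    case True
    then show ?thesis using span_over_base[OF fin] by simp
  next
    case False
    then have "\<not> independent_over A (insert x B)"
      using max[of "insert x B"] B that by blast
    then obtain k where k: "\<forall>b\<in>insert x B. k b \<in> A" "(\<Sum>b\<in>insert x B. k b *s b) = 0"
      and nz: "\<exists>b\<in>insert x B. k b \<noteq> 0"
      unfolding independent_over_def by blast
    have s: "k x *s x + (\<Sum>b\<in>B. k b *s b) = 0" using k(2) fin False by simp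
    have "k x \<noteq> 0"
    proof
      assume "k x = 0"
      then have "\<forall>b\<in>B. k b = 0"
        using s k(1) B(2) unfolding independent_over_def by simp
      then show False using nz \<open>k x = 0\<close> by auto
    qed
    have "k x *s x = - (\<Sum>b\<in>B. k b *s b)" using s by (simp add: eq_neg_iff_add_eq_0)
    then have xeq: "x = (- inverse (k x)) *s (\<Sum>b\<in>B. k b *s b)"
      using \<open>k x \<noteq> 0\<close> by (metis left_inverse vec.scale_minus_left vec.scale_minus_right vec.scale_one vec.scale_scale)
    have "(\<Sum>b\<in>B. k b *s b) \<in> span_over A B"
      using k(1) by (auto simp: span_over_def)
    moreover have "- inverse (k x) \<in> A" using k(1) by (auto intro: uminus inverse)
    ultimately have "(- inverse (k x)) *s (\<Sum>b\<in>B. k b *s b) \<in> span_over A B"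
      using submodule_span_over[of B] unfolding submodule_over_def by blast
    then show ?thesis by (subst xeq)
  qed
  then show ?thesis using B by blast
qed

lemma vdot_axis: "vdot u (axis i 1) = u $ i"
proof -
  have "vdot u (axis i 1) = (\<Sum>j\<in>UNIV. if j = i then u $ j else 0)"
    unfolding vdot_def by (intro sum.cong) (auto simp: axis_def)
  then show ?thesis by simp
qed

context subring_of_field
begin

text \<open>
  A maximal \<open>K\<close>-independent set \<open>B\<close> of generators (\<open>K\<close> the field of fractions) is \<open>'f\<close>-independent:
  the \<open>K\<close>-coordinates with respect to \<open>B\<close> are \<open>A\<close>-linear on \<open>L\<close> and extend to the tensor product,
  where injectivity turns an \<open>'f\<close>-linear relation of \<open>B\<close> into zero.
\<close>

lemma lattice_over_basis:
  fixes L :: "('f ^ 'd) set"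
  assumes "lattice_over A L"
  obtains E :: "'f ^ 'd ^ 'd" where "det E \<noteq> 0" "\<forall>j. column j E \<in> L"
    "\<forall>c. E *v c \<in> L \<longrightarrow> (\<forall>i. c $ i \<in> fraction_field_in A)"
proof -
  let ?K = "fraction_field_in A"
  interpret K: subfield_of_field ?K by (rule subfield_fraction_field)
  have sub: "submodule_over A L" and fg: "finitely_generated_over A L"
    and bij: "bij_betw tensor_natural_map (carrier (tensor_product A L)) UNIV"
    using assms by (auto simp: lattice_over_def)
  have tinj: "\<And>t. Poly_Mapping.keys t \<subseteq> UNIV \<times> L \<Longrightarrow> tensor_eval t = 0 \<Longrightarrow> t \<in> tensor_relations A L"
    and tsurj: "\<And>v. \<exists>t. Poly_Mapping.keys t \<subseteq> UNIV \<times> L \<and> tensor_eval t = v"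
    using bij_natural_map_iff[OF sub] bij by blast+
  obtain S where S: "finite S" "S \<subseteq> L" "L = span_over A S"
    using fg unfolding finitely_generated_over_iff by (elim exE conjE)
  obtain B where B: "B \<subseteq> S" "independent_over ?K B" "S \<subseteq> span_over ?K B"
    using K.exists_independent_over_spanning[OF S(1)] by blast
  have fin: "finite B" using B S finite_subset by blast
  have BL: "B \<subseteq> L" using B S by blast
  have "submodule_over A (span_over ?K B)"
    using K.submodule_span_over[of B] fraction_subset by (auto simp: submodule_over_def)
  then have LK: "L \<subseteq> span_over ?K B"
    using span_over_least B(3) S(3) by blast
  \<comment> \<open>The coordinates of \<open>x \<in> L\<close> over \<open>?K\<close>; independence
    of \<open>B\<close> over \<open>?K\<close> makes them unique, hence \<open>A\<close>-linear in
    \<open>x\<close>.\<close>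
  have "\<exists>\<phi>. \<forall>x\<in>L. (\<forall>b\<in>B. \<phi> x b \<in> ?K) \<and> x = (\<Sum>b\<in>B. \<phi> x b *s b)"
  proof (rule bchoice, rule ballI)
    fix x assume "x \<in> L"
    then have "x \<in> span_over ?K B" using LK by blast
    then show "\<exists>k. (\<forall>b\<in>B. k b \<in> ?K) \<and> x = (\<Sum>b\<in>B. k b *s b)"
      unfolding span_over_def by blast
  qed
  then obtain \<phi> where \<phi>K: "\<And>x b. x \<in> L \<Longrightarrow> b \<in> B \<Longrightarrow> \<phi> x b \<in> ?K"
    and \<phi>: "\<And>x. x \<in> L \<Longrightarrow> x = (\<Sum>b\<in>B. \<phi> x b *s b)" by blast
  have \<phi>I: "k b = \<phi> x b"
    if "x \<in> L" "\<And>b. b \<in> B \<Longrightarrow> k b \<in> ?K" "x = (\<Sum>b\<in>B. k b *s b)" "b \<in> B" for k x b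
    using that \<phi>[OF that(1)] \<phi>K[OF that(1)] by (intro K.independent_over_unique[OF B(2)]) auto
  have \<phi>_add: "\<phi> (x + y) b = \<phi> x b + \<phi> y b" if "x \<in> L" "y \<in> L" "b \<in> B" for x y b
  proof -
    have "x + y = (\<Sum>b\<in>B. (\<phi> x b + \<phi> y b) *s b)"
      using \<phi>[OF that(1)] \<phi>[OF that(2)] by (simp add: vec.scale_left_distrib sum.distrib)
    moreover have "x + y \<in> L" using that sub by (simp add: submodule_over_def)
    ultimately show ?thesis
      using \<phi>I[of "x + y" "\<lambda>b. \<phi> x b + \<phi> y b" b] that \<phi>K by (simp add: K.add)
  qed
  have \<phi>_scale: "\<phi> (a *s x) b = a * \<phi> x b" if "a \<in> A" "x \<in> L" "b \<in> B" for a x b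
  proof -
    have "a *s x = a *s (\<Sum>b\<in>B. \<phi> x b *s b)" using \<phi>[OF that(2)] by simp
    also have "\<dots> = (\<Sum>b\<in>B. (a * \<phi> x b) *s b)" by (simp add: vec.scale_sum_right)
    finally have "a *s x = (\<Sum>b\<in>B. (a * \<phi> x b) *s b)" .
    moreover have "a *s x \<in> L" using that sub by (simp add: submodule_over_def)
    ultimately show ?thesis
      using \<phi>I[of "a *s x" "\<lambda>b. a * \<phi> x b" b] that \<phi>K fraction_subset by (simp add: K.mult)
  qed
  have \<phi>_B: "\<phi> b' b = (if b' = b then 1 else 0)" if "b \<in> B" "b' \<in> B" for b b'
  proof -
    have "(\<Sum>b\<in>B. (if b' = b then 1 else 0) *s b) = (\<Sum>b\<in>B. if b' = b then b else 0)"
      by (intro sum.cong) auto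
    then have "b' = (\<Sum>b\<in>B. (if b' = b then 1 else 0) *s b)" using that fin by simp
    moreover have "b' \<in> L" using that BL by blast
    ultimately show ?thesis using \<phi>I[of b' "\<lambda>b. if b' = b then 1 else 0" b] that by simp
  qed
  have indep: "c b = 0" if "(\<Sum>b\<in>B. c b *s b) = 0" "b \<in> B" for c b
  proof -
    let ?t = "\<Sum>b\<in>B. frag_of (c b, b)"
    have "Poly_Mapping.keys ?t \<subseteq> (\<Union>b\<in>B. Poly_Mapping.keys (frag_of (c b, b)))"
      by (rule keys_sum)
    also have "\<dots> \<subseteq> UNIV \<times> L" using BL by (auto simp: keys_frag_of)
    finally have "?t \<in> tensor_relations A L"
      using that(1) by (intro tinj) (simp_all add: tensor_eval_sum tensor_eval_frag_of)
    then have "free_eval (\<lambda>(c, x). c * \<phi> x b) ?t = 0"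
      using free_eval_relations[OF sub, of ?t "\<lambda>x. \<phi> x b"] \<phi>_add \<phi>_scale that(2) by simp
    moreover have "free_eval (\<lambda>(c, x). c * \<phi> x b) ?t = (\<Sum>b'\<in>B. if b' = b then c b' else 0)"
      using that(2) by (auto simp: free_eval_sum \<phi>_B intro!: sum.cong)
    ultimately show ?thesis using that(2) fin by simp
  qed
  have ann: "u = 0" if u: "\<And>x. x \<in> B \<Longrightarrow> vdot u x = 0" for u
  proof -
    have uL: "vdot u x = 0" if "x \<in> L" for x
    proof -
      have "vdot u (\<Sum>b\<in>B. \<phi> x b *s b) = 0"
        unfolding vdot_sum using u by (intro sum.neutral) simp
      then show ?thesis using \<phi>[OF that] by simp
    qed
    have "vdot u v = 0" for v
    proof -
      obtain t where t: "Poly_Mapping.keys t \<subseteq> UNIV \<times> L" "tensor_eval t = v" using tsurj by blast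
      have "vdot u (tensor_eval t) = 0"
        unfolding tensor_eval_def vdot_sum using t(1) uL by (intro sum.neutral) auto
      then show ?thesis using t by simp
    qed
    from this[of "axis i 1" for i] show "u = 0" by (simp add: vdot_axis vec_eq_iff)
  qed
  obtain b where b: "\<And>i. b i \<in> B" "det (\<chi> i. b i) \<noteq> 0"
    using exists_basis_in[of B] ann by blast
  have inj: "i = j" if "b i = b j" for i j
  proof (rule ccontr)
    assume "i \<noteq> j"
    then have "det (\<chi> i. b i) = 0"
      using that by (intro det_identical_rows[of i j]) (simp_all add: row_def)
    then show False using b by simp
  qed
  let ?E = "transpose (\<chi> i. b i)"
  have E: "?E *v c = (\<Sum>i\<in>UNIV. c $ i *s b i)" for c
    by (auto simp: vec_eq_iff matrix_vector_mult_def transpose_def mult.commute)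
  show ?thesis
  proof (intro that[of ?E] allI impI)
    show "det ?E \<noteq> 0" using b by simp
    have "column j ?E = b j" for j by (simp add: column_def transpose_def vec_eq_iff)
    then show "column j ?E \<in> L" for j using b BL by auto
    fix c i assume cL: "?E *v c \<in> L"
    \<comment> \<open>The coefficients are moved from the index type to \<open>B\<close>: the empty
      sum gives 0 off the range of \<open>b\<close>, so both expansions can be compared over all of
      \<open>B\<close>.\<close>
    define c' where "c' \<beta> = (\<Sum>i | b i = \<beta>. c $ i)" for \<beta>
    have c': "c' (b i) = c $ i" for i
    proof -
      have "{j. b j = b i} = {i}" using inj by blast
      then show ?thesis by (simp add: c'_def)
    qed
    have "(\<Sum>\<beta>\<in>B. c' \<beta> *s \<beta>) = (\<Sum>\<beta>\<in>range b. c' \<beta> *s \<beta>)"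
    proof (rule sum.mono_neutral_right[OF fin])
      show "range b \<subseteq> B" using b by blast
      show "\<forall>\<beta>\<in>B - range b. c' \<beta> *s \<beta> = 0"
      proof
        fix \<beta> assume "\<beta> \<in> B - range b"
        then have "{i. b i = \<beta>} = {}" by blast
        then show "c' \<beta> *s \<beta> = 0" unfolding c'_def by simp
      qed
    qed
    also have "\<dots> = ?E *v c" unfolding E
      by (subst sum.reindex) (auto intro: injI inj simp: c')
    also have "\<dots> = (\<Sum>\<beta>\<in>B. \<phi> (?E *v c) \<beta> *s \<beta>)" by (rule \<phi>[OF cL])
    finally have "(\<Sum>\<beta>\<in>B. (c' \<beta> - \<phi> (?E *v c) \<beta>) *s \<beta>) = 0"
      by (simp add: vec.scale_left_diff_distrib sum_subtractf)
    then have "c' (b i) - \<phi> (?E *v c) (b i) = 0"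
      by (rule indep) (rule b)
    then show "c $ i \<in> ?K" using \<phi>K[OF cL b(1), of i] by (simp add: c')
  qed
qed

end

text \<open>The rows of \<open>B\<close> act as functionals. If they take values in the subfield on
  the columns of \<open>E\<close> and on \<open>E *v c\<close>, then \<open>c\<close> solves a
  system with matrix \<open>B ** E\<close> over the subfield.\<close>

lemma (in subfield_of_field) coordinates:
  fixes B E :: "'a ^ 'd ^ 'd"
  assumes "det B \<noteq> 0" "det E \<noteq> 0" "\<And>i j. (B *v column j E) $ i \<in> A" "\<And>i. (B *v (E *v c)) $ i \<in> A"
  shows "c $ k \<in> A"
proof (rule linear_system[of "B ** E"])
  show "det (B ** E) \<noteq> 0" using assms by (simp add: det_mul)
  show "((B ** E) *v c) $ i \<in> A" for i using assms(4) by (simp add: matrix_vector_mul_assoc)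
  have "(B ** E) $ i $ j = (B *v column j E) $ i" for i j
    by (simp add: matrix_matrix_mult_def matrix_vector_mult_def column_def)
  then show "(B ** E) $ i $ j \<in> A" for i j using assms(3) by simp
qed

lemma tensor_congruences:
  assumes "submodule_over A L"
  shows "x \<in> L \<Longrightarrow> frag_of (c + c', x) - frag_of (c, x) - frag_of (c', x) \<in> tensor_relations A L"
    and "x \<in> L \<Longrightarrow> y \<in> L \<Longrightarrow> frag_of (c, x + y) - frag_of (c, x) - frag_of (c, y) \<in> tensor_relations A L"
    and "a \<in> A \<Longrightarrow> x \<in> L \<Longrightarrow> frag_of (c * a, x) - frag_of (c, a *s x) \<in> tensor_relations A L"
    and "x \<in> L \<Longrightarrow> frag_of (0, x) \<in> tensor_relations A L"
    and "frag_of (c, 0) \<in> tensor_relations A L"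
proof -
  show 1: "frag_of (c + c', x) - frag_of (c, x) - frag_of (c', x) \<in> tensor_relations A L"
    if "x \<in> L" for c c' x
    unfolding tensor_relations_def
    by (intro generate.incl) (use that in \<open>auto simp: tensor_relators_def\<close>)
  show 2: "frag_of (c, x + y) - frag_of (c, x) - frag_of (c, y) \<in> tensor_relations A L"
    if "x \<in> L" "y \<in> L" for c x y
    unfolding tensor_relations_def
    by (intro generate.incl) (use that in \<open>auto simp: tensor_relators_def\<close>)
  show "frag_of (c * a, x) - frag_of (c, a *s x) \<in> tensor_relations A L" if "a \<in> A" "x \<in> L"
    unfolding tensor_relations_def
    by (intro generate.incl) (use that in \<open>auto simp: tensor_relators_def\<close>)
  show "frag_of (0, x) \<in> tensor_relations A L" if "x \<in> L"
    using 1[OF that, of 0 0] tensor_relations_closed(3)[OF assms] by fastforce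
  have "0 \<in> L" using assms by (simp add: submodule_over_def)
  then show "frag_of (c, 0) \<in> tensor_relations A L"
    using 2[of 0 0 c] tensor_relations_closed(3)[OF assms] by fastforce
qed

lemma tensor_congruence_sum:
  assumes "submodule_over A L" "finite I" "\<And>i. i \<in> I \<Longrightarrow> y i \<in> L"
  shows "frag_of (c, \<Sum>i\<in>I. y i) - (\<Sum>i\<in>I. frag_of (c, y i)) \<in> tensor_relations A L"
  using assms(2,3)
proof (induction I)
  case empty
  then show ?case using tensor_congruences(5)[OF assms(1)] by simp
next
  case (insert i I)
  let ?s = "\<Sum>i\<in>I. y i"
  have "?s \<in> L" by (rule submodule_sum[OF assms(1)]) (use insert.prems in auto)
  then have "frag_of (c, y i + ?s) - frag_of (c, y i) - frag_of (c, ?s) \<in> tensor_relations A L"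
    using insert.prems by (intro tensor_congruences[OF assms(1)]) auto
  moreover have "frag_of (c, ?s) - (\<Sum>i\<in>I. frag_of (c, y i)) \<in> tensor_relations A L"
    using insert by auto
  ultimately have "(frag_of (c, y i + ?s) - frag_of (c, y i) - frag_of (c, ?s)) +
      (frag_of (c, ?s) - (\<Sum>i\<in>I. frag_of (c, y i))) \<in> tensor_relations A L"
    by (rule tensor_relations_closed[OF assms(1)])
  then show ?case using insert.hyps by (simp add: algebra_simps)
qed

context subring_of_field
begin

text \<open>Choose a basis \<open>b\<close> inside \<open>L\<close>. The rows of \<open>M\<close>
  are functionals that force the coordinates of elements of \<open>L\<close> into the field of
  fractions, so every tensor is congruent to a normal form \<open>\<Sum> C i \<otimes> b i\<close>.
  Evaluation reads off the coordinates \<open>C\<close>, so only the zero tensor evaluates to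
  0.\<close>

lemma lattice_overI:
  fixes L :: "('f ^ 'd) set" and M :: "'f ^ 'd ^ 'd"
  assumes sub: "submodule_over A L" and fg: "finitely_generated_over A L"
    and span: "\<And>u. (\<And>x. x \<in> L \<Longrightarrow> vdot u x = 0) \<Longrightarrow> u = 0"
    and M: "det M \<noteq> 0" "\<And>x i. x \<in> L \<Longrightarrow> (M *v x) $ i \<in> fraction_field_in A"
  shows "lattice_over A L"
proof -
  let ?K = "fraction_field_in A" and ?R = "tensor_relations A L"
  interpret K: subfield_of_field ?K by (rule subfield_fraction_field)
  note closed = tensor_relations_closed[OF sub] and cong = tensor_congruences[OF sub]
  obtain b where bL: "\<And>i. b i \<in> L" and "det (\<chi> i. b i) \<noteq> 0"
    using exists_basis_in[of L] span by blast
  then have detE: "det (transpose (\<chi> i. b i)) \<noteq> 0" by simp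
  have E: "transpose (\<chi> i. b i) *v c = (\<Sum>i\<in>UNIV. c $ i *s b i)" for c
    by (auto simp: vec_eq_iff matrix_vector_mult_def transpose_def mult.commute)
  have col: "column j (transpose (\<chi> i. b i)) = b j" for j
    by (simp add: column_def transpose_def vec_eq_iff)
  have coords: "\<exists>c. (\<Sum>i\<in>UNIV. c $ i *s b i) = v" for v
    using cramer[OF detE, of _ v] unfolding E by blast
  have coordsK: "c $ k \<in> ?K" if "(\<Sum>i\<in>UNIV. c $ i *s b i) \<in> L" for c k
    by (rule K.coordinates[OF M(1) detE]; unfold E col; intro M(2) that bL)
  have coords0: "c $ k = 0" if "(\<Sum>i\<in>UNIV. c $ i *s b i) = 0" for c k
  proof -
    have c: "transpose (\<chi> i. b i) *v c = 0" "transpose (\<chi> i. b i) *v 0 = 0"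
      unfolding E using that by simp_all
    have "c = 0"
      by (rule trans[OF iffD1[OF cramer[OF detE] c(1)] iffD1[OF cramer[OF detE] c(2), symmetric]])
    then show ?thesis by simp
  qed
  define nf where "nf C = (\<Sum>i\<in>UNIV. frag_of (C i, b i))" for C :: "'d \<Rightarrow> 'f"
  have nf_eval: "tensor_eval (nf C) = (\<Sum>i\<in>UNIV. (\<chi> i. C i) $ i *s b i)" for C
    by (simp add: nf_def tensor_eval_sum tensor_eval_frag_of)
  have nf_diff: "nf C - nf D - nf (\<lambda>i. C i - D i) \<in> ?R" for C D
  proof -
    have "nf C - nf D - nf (\<lambda>i. C i - D i) =
      (\<Sum>i\<in>UNIV. frag_of (D i + (C i - D i), b i) - frag_of (D i, b i) - frag_of (C i - D i, b i))"
      by (simp add: nf_def sum_subtractf)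
    also have "\<dots> \<in> ?R" by (intro tensor_relations_sum[OF sub] cong bL)
    finally show ?thesis .
  qed
  have nf_0: "nf (\<lambda>i. 0) \<in> ?R"
    unfolding nf_def by (intro tensor_relations_sum[OF sub] cong bL)
  have pure: "\<exists>C. frag_of (c, x) - nf C \<in> ?R" if x: "x \<in> L" for c x
  proof -
    obtain k where k: "(\<Sum>i\<in>UNIV. k $ i *s b i) = x" using coords by blast
    then have kK: "k $ i \<in> ?K" for i using coordsK x by simp
    obtain d where d: "d \<in> A" "d \<noteq> 0" "\<And>i. d * k $ i \<in> A"
      using common_denominator[of UNIV "\<lambda>i. k $ i"] kK by auto
    let ?e = "c / d"
    \<comment> \<open>With a common denominator \<open>d\<close>, the tensor
      \<open>c \<otimes> x\<close> equals \<open>(c / d) \<otimes> (d *s x)\<close>, and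
      \<open>d *s x\<close> is an \<open>A\<close>-combination of the basis.\<close>
    have ce: "c = ?e * d" using d by simp
    have dx: "d *s x = (\<Sum>i\<in>UNIV. (d * k $ i) *s b i)"
      by (simp add: k[symmetric] vec.scale_sum_right)
    have bi: "(d * k $ i) *s b i \<in> L" for i using d bL sub by (simp add: submodule_over_def)
    have "frag_of (?e * d, x) - frag_of (?e, d *s x) \<in> ?R" by (intro cong d x)
    moreover have "frag_of (?e, d *s x) - (\<Sum>i\<in>UNIV. frag_of (?e, (d * k $ i) *s b i)) \<in> ?R"
      unfolding dx by (intro tensor_congruence_sum[OF sub] bi) simp
    moreover have "nf (\<lambda>i. ?e * (d * k $ i)) - (\<Sum>i\<in>UNIV. frag_of (?e, (d * k $ i) *s b i)) \<in> ?R"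
      unfolding nf_def sum_subtractf[symmetric] by (intro tensor_relations_sum[OF sub] cong d bL)
    ultimately have "(frag_of (?e * d, x) - frag_of (?e, d *s x))
        + (frag_of (?e, d *s x) - (\<Sum>i\<in>UNIV. frag_of (?e, (d * k $ i) *s b i)))
        - (nf (\<lambda>i. ?e * (d * k $ i)) - (\<Sum>i\<in>UNIV. frag_of (?e, (d * k $ i) *s b i))) \<in> ?R"
      by (rule closed(4)[OF closed(2)])
    then have "frag_of (?e * d, x) - nf (\<lambda>i. ?e * (d * k $ i)) \<in> ?R" by simp
    then show ?thesis unfolding ce[symmetric] by blast
  qed
  have normal: "\<exists>C. t - nf C \<in> ?R" if "Poly_Mapping.keys t \<subseteq> UNIV \<times> L" for t
    using that
  proof (induction t rule: frag_induction)
    case zero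
    then show ?case using closed(3)[OF nf_0] by (intro exI[of _ "\<lambda>i. 0"]) simp
  next
    case (one x)
    then show ?case using pure by (cases x) auto
  next
    case (diff s t)
    then obtain C D where "s - nf C \<in> ?R" "t - nf D \<in> ?R" by blast
    then have "(s - nf C) - (t - nf D) + (nf C - nf D - nf (\<lambda>i. C i - D i)) \<in> ?R"
      using nf_diff by (rule closed(2)[OF closed(4)])
    then show ?case by (intro exI[of _ "\<lambda>i. C i - D i"]) (simp add: algebra_simps)
  qed
  have "t \<in> ?R" if t: "Poly_Mapping.keys t \<subseteq> UNIV \<times> L" "tensor_eval t = 0" for t
  proof -
    obtain C where C: "t - nf C \<in> ?R" using normal t by blast
    then have "tensor_eval (t - nf C) = 0"
      using tensor_eval_relations[OF sub] by (simp add: tensor_relations_def)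
    then have "tensor_eval (nf C) = 0" using t(2) by (simp add: tensor_eval_diff)
    then have "(\<chi> i. C i) $ k = 0" for k unfolding nf_eval by (rule coords0)
    then have "C = (\<lambda>i. 0)" by auto
    then show ?thesis using closed(2)[OF C, of "nf C"] nf_0 by simp
  qed
  moreover have "\<exists>t. Poly_Mapping.keys t \<subseteq> UNIV \<times> L \<and> tensor_eval t = v" for v
  proof -
    obtain c where c: "(\<Sum>i\<in>UNIV. c $ i *s b i) = v" using coords by blast
    have "Poly_Mapping.keys (nf (\<lambda>i. c $ i)) \<subseteq> (\<Union>i\<in>UNIV. Poly_Mapping.keys (frag_of (c $ i, b i)))"
      unfolding nf_def by (rule keys_sum)
    also have "\<dots> \<subseteq> UNIV \<times> L" using bL by (auto simp: keys_frag_of)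
    finally show ?thesis
      using c nf_eval[of "\<lambda>i. c $ i"] by (intro exI[of _ "nf (\<lambda>i. c $ i)"]) simp
  qed
  ultimately have "bij_betw tensor_natural_map (carrier (tensor_product A L)) UNIV"
    using bij_natural_map_iff[OF sub] by blast
  then show ?thesis using sub fg by (simp add: lattice_over_def)
qed

end

section \<open>Integrality and eigenvalues on lattices\<close>

lemma integral_overI:
  assumes "subring_of_field A" "\<And>j. j < m \<Longrightarrow> a j \<in> A" "p ^ m = (\<Sum>j<m. a j * p ^ j)"
  shows "integral_over A p"
proof -
  interpret subring_of_field A by fact
  let ?P = "Polynomial.monom 1 m - (\<Sum>j<m. Polynomial.monom (a j) j)"
  have coeff: "Polynomial.coeff ?P i = (if i = m then 1 else if i < m then - a i else 0)" for i
    by (auto simp: coeff_sum Polynomial.coeff_monom)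
  have "Polynomial.degree ?P = m"
  proof (rule antisym)
    show "Polynomial.degree ?P \<le> m" by (rule degree_le) (simp only: coeff, auto)
    show "m \<le> Polynomial.degree ?P" by (rule le_degree) (simp only: coeff, auto)
  qed
  then have "Polynomial.lead_coeff ?P = 1" using coeff[of m] by simp
  moreover have "Polynomial.coeff ?P i \<in> A" for i
    unfolding coeff using assms(2) by (auto intro: uminus)
  moreover have "poly ?P p = 0" using assms(3) by (simp add: poly_sum poly_monom)
  ultimately show ?thesis unfolding integral_over_def by blast
qed

text \<open>
  The ideals generated by the \<open>q * p\<^sup>j\<close> with \<open>j < m\<close> form an ascending chain in \<open>m\<close>.
\<close>

lemma noetherian_integral:
  fixes A :: "'f::field set"
  assumes A: "integrally_closed_noetherian_subring A" and "q \<noteq> 0" "\<And>m. q * p ^ m \<in> A"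
  shows "integral_over A p"
proof -
  let ?R = "(ring_of_type_algebra :: 'f ring)\<lparr>carrier := A\<rparr>"
  have sub: "subring_of_field A" and noeth: "noetherian_ring ?R"
    using A by (auto simp: integrally_closed_noetherian_subring_def subring_of_fieldI)
  interpret subring_of_field A by (rule sub)
  interpret R: noetherian_ring ?R by (rule noeth)
  have inv: "inv\<^bsub>add_monoid ?R\<^esub> x = - x" if "x \<in> A" for x
    using R.minus_equality[of "- x" x] that uminus by (simp add: ring_of_type_algebra_def a_inv_def)
  \<comment> \<open>Multiplication by \<open>q\<close> moves the \<open>A\<close>-span of the first
    \<open>m\<close> powers of \<open>p\<close> into \<open>A\<close>, where it becomes an ideal, so
    that the chain condition on ideals applies.\<close>
  define J where "J m = {\<Sum>j<m. a j * (q * p ^ j) | a. \<forall>j. a j \<in> A}" for m :: nat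
  have J0: "0 \<in> J m" for m unfolding J_def by (auto intro!: exI[of _ "\<lambda>_. 0"])
  have Jadd: "x + y \<in> J m" if "x \<in> J m" "y \<in> J m" for x y m
  proof -
    obtain a b where "\<forall>j. a j \<in> A" "x = (\<Sum>j<m. a j * (q * p ^ j))"
      "\<forall>j. b j \<in> A" "y = (\<Sum>j<m. b j * (q * p ^ j))"
      using \<open>x \<in> J m\<close> \<open>y \<in> J m\<close> unfolding J_def by blast
    then have "\<forall>j. a j + b j \<in> A" "x + y = (\<Sum>j<m. (a j + b j) * (q * p ^ j))"
      by (simp_all add: distrib_right sum.distrib add)
    then show ?thesis unfolding J_def mem_Collect_eq by (intro exI[of _ "\<lambda>j. a j + b j"]) simp
  qed
  have Jmult: "c * x \<in> J m" if "c \<in> A" "x \<in> J m" for c x m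
  proof -
    obtain a where "\<forall>j. a j \<in> A" "x = (\<Sum>j<m. a j * (q * p ^ j))"
      using \<open>x \<in> J m\<close> unfolding J_def by blast
    then have "\<forall>j. c * a j \<in> A" "c * x = (\<Sum>j<m. (c * a j) * (q * p ^ j))"
      using that by (simp_all add: sum_distrib_left mult mult.assoc)
    then show ?thesis unfolding J_def mem_Collect_eq by (intro exI[of _ "\<lambda>j. c * a j"]) simp
  qed
  have JA: "J m \<subseteq> A" for m
    unfolding J_def by (auto intro!: sum mult assms(3))
  have ideal: "ideal (J m) ?R" for m
  proof (rule idealI)
    show "ring ?R" by (rule R.ring_axioms)
    show "subgroup (J m) (add_monoid ?R)"
    proof
      show "J m \<subseteq> carrier (add_monoid ?R)" using JA by simp
      show "\<one>\<^bsub>add_monoid ?R\<^esub> \<in> J m" using J0 by (simp add: ring_of_type_algebra_def)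
      show "x \<otimes>\<^bsub>add_monoid ?R\<^esub> y \<in> J m" if "x \<in> J m" "y \<in> J m" for x y
        using Jadd that by (simp add: ring_of_type_algebra_def)
      show "inv\<^bsub>add_monoid ?R\<^esub> x \<in> J m" if "x \<in> J m" for x
      proof -
        have "- 1 * x \<in> J m" using that by (intro Jmult uminus one)
        then show ?thesis using inv[OF subsetD[OF JA that]] by simp
      qed
    qed
    show "x \<otimes>\<^bsub>?R\<^esub> a \<in> J m" "a \<otimes>\<^bsub>?R\<^esub> x \<in> J m" if "a \<in> J m" "x \<in> carrier ?R" for a x
      using Jmult[of x a m] that by (simp_all add: ring_of_type_algebra_def mult.commute)
  qed
  have mono: "J m \<subseteq> J n" if "m \<le> n" for m n
  proof
    fix x assume "x \<in> J m"
    then obtain a where a: "\<forall>j. a j \<in> A" "x = (\<Sum>j<m. a j * (q * p ^ j))"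
      unfolding J_def by blast
    have "(\<Sum>j<n. (if j < m then a j else 0) * (q * p ^ j)) = (\<Sum>j<m. (if j < m then a j else 0) * (q * p ^ j))"
      by (rule sum.mono_neutral_right) (use that in auto)
    then have "x = (\<Sum>j<n. (if j < m then a j else 0) * (q * p ^ j))" using a by simp
    then show "x \<in> J n" unfolding J_def mem_Collect_eq
      by (intro exI[of _ "\<lambda>j. if j < m then a j else 0"]) (use a in auto)
  qed
  have "subset.chain {I. ideal I ?R} (range J)"
    unfolding subset_chain_def using ideal mono nat_le_linear by blast
  \<comment> \<open>In a Noetherian ring the union of the chain is one of its members. If it is
    \<open>J m\<close>, then \<open>q * p ^ m\<close>, which lies in \<open>J (Suc m)\<close>, is a
    combination of the lower powers.\<close>
  then have "\<Union>(range J) \<in> range J" by (intro R.ideal_chain_is_trivial) auto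
  then obtain m where m: "(\<Union>n. J n) = J m" by blast
  have "q * p ^ m \<in> J (Suc m)" unfolding J_def mem_Collect_eq
    by (intro exI[of _ "\<lambda>j. if j = m then 1 else 0"]) (simp add: sum.delta)
  then have "q * p ^ m \<in> J m" using m by blast
  then obtain a where a: "\<forall>j. a j \<in> A" "q * p ^ m = (\<Sum>j<m. a j * (q * p ^ j))"
    unfolding J_def by blast
  have "q * p ^ m = q * (\<Sum>j<m. a j * p ^ j)"
    unfolding a(2) by (simp add: sum_distrib_left mult_ac)
  then have "p ^ m = (\<Sum>j<m. a j * p ^ j)" using \<open>q \<noteq> 0\<close> by simp
  then show ?thesis using integral_overI[OF sub] a(1) by blast
qed

lemma matrix_surj:
  fixes E :: "'f::field ^ 'd ^ 'd"
  assumes "det E \<noteq> 0"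
  obtains c where "E *v c = x"
  using cramer[OF assms] by blast

lemma matrix_inj:
  fixes E :: "'f::field ^ 'd ^ 'd"
  assumes "det E \<noteq> 0" "E *v c = E *v d"
  shows "c = d"
  by (rule trans[OF iffD1[OF cramer[OF assms(1)] assms(2)] iffD1[OF cramer[OF assms(1)] refl, symmetric]])

text \<open>All \<open>p ^ m *s w\<close> stay in \<open>L\<close>. A nonzero coordinate of
  \<open>w\<close> in a lattice basis shows that \<open>p\<close> is a fraction, and a common
  denominator for that coordinate of the finitely many generators of \<open>L\<close> bounds the
  denominators of all powers of \<open>p\<close>; integral closedness then applies.\<close>

lemma lattice_eigenvalue:
  fixes A :: "'f::field set"
  assumes A: "integrally_closed_noetherian_subring A" and L: "lattice_over A L"
    and M: "\<And>x. x \<in> L \<Longrightarrow> M *v x \<in> L" and w: "w \<in> L" "w \<noteq> 0" "M *v w = p *s w"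
  shows "p \<in> A"
proof -
  have "subring_of_field A"
    using A by (auto simp: integrally_closed_noetherian_subring_def subring_of_fieldI)
  then interpret subring_of_field A .
  let ?K = "fraction_field_in A"
  interpret K: subfield_of_field ?K by (rule subfield_fraction_field)
  obtain E where E: "det E \<noteq> 0" "\<forall>j. column j E \<in> L"
    "\<forall>c. E *v c \<in> L \<longrightarrow> (\<forall>i. c $ i \<in> ?K)"
    by (rule lattice_over_basis[OF L])
  obtain S where S: "finite S" "S \<subseteq> L" "L = span_over A S"
    using L unfolding lattice_over_def finitely_generated_over_iff by (elim exE conjE)
  obtain c where c: "E *v c = w" using matrix_surj[OF E(1)] .
  have "c \<noteq> 0" using c w(2) by auto
  then obtain i where i: "c $ i \<noteq> 0" by (auto simp: vec_eq_iff)
  have pow: "p ^ m *s w \<in> L" for m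
  proof (induction m)
    case (Suc m)
    have "M *v (p ^ m *s w) = p ^ Suc m *s w"
      using w(3) by (simp add: vec.scale mult.commute)
    then show ?case using M[OF Suc] by simp
  qed (use w in simp)
  have Epow: "E *v (p ^ m *s c) = p ^ m *s w" for m using c by (simp add: vec.scale)
  have "E *v (p *s c) \<in> L" using Epow[of 1] pow[of 1] by simp
  then have "(p *s c) $ i \<in> ?K" using E(3) by blast
  moreover have "c $ i \<in> ?K" using E(3) c w by blast
  ultimately have "p * c $ i / c $ i \<in> ?K" by (intro K.divide) simp_all
  then have pK: "p \<in> ?K" using i by simp
  have "\<forall>s. \<exists>k. E *v k = s" using matrix_surj[OF E(1)] by metis
  then obtain k where k: "\<And>s. E *v k s = s" by metis
  have "\<exists>d\<in>A. d \<noteq> 0 \<and> (\<forall>s\<in>S. d * (k s $ i) \<in> A)"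
    using S k E(3) by (intro common_denominator) auto
  then obtain d where d: "d \<in> A" "d \<noteq> 0" "\<And>s. s \<in> S \<Longrightarrow> d * (k s $ i) \<in> A" by blast
  have dL: "d * (k x $ i) \<in> A" if "x \<in> L" for x
  proof -
    have "x \<in> span_over A S" using that S(3) by simp
    then
    obtain a where a: "\<forall>s\<in>S. a s \<in> A" "x = (\<Sum>s\<in>S. a s *s s)"
      by (rule span_overE)
    have "E *v (\<Sum>s\<in>S. a s *s k s) = E *v k x"
      using a(2) by (simp add: k vec.scale vec.sum)
    then have kx: "k x = (\<Sum>s\<in>S. a s *s k s)" using matrix_inj[OF E(1)] by metis
    have "d * (k x $ i) = (\<Sum>s\<in>S. a s * (d * (k s $ i)))"
      unfolding kx by (simp add: sum_distrib_left mult_ac)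
    also have "\<dots> \<in> A" by (rule sum, rule mult) (use a d in auto)
    finally show ?thesis .
  qed
  have "(d * c $ i) * p ^ m \<in> A" for m
  proof -
    have "k (p ^ m *s w) = p ^ m *s c" by (rule matrix_inj[OF E(1)]) (simp only: k Epow)
    then show ?thesis using dL[OF pow[of m]] by (simp add: mult_ac)
  qed
  then have "integral_over A p"
    using noetherian_integral[OF A, of "d * c $ i" p] d i by simp
  then show ?thesis
    using A pK by (auto simp: integrally_closed_noetherian_subring_def integrally_closed_def)
qed

section \<open>Path products\<close>

fun path_product :: "('i \<Rightarrow> 'i \<Rightarrow> 'f::field) \<Rightarrow> 'i list \<Rightarrow> 'f" where
  "path_product C (i # j # is) = C i j * path_product C (j # is)"
| "path_product C is = 1"

lemma path_product_Cons: "is \<noteq> [] \<Longrightarrow> path_product C (i # is) = C i (hd is) * path_product C is"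
  by (cases "is") auto

lemma path_product_append:
  "path_product C (is @ j # js) = path_product C (is @ [j]) * path_product C (j # js)"
proof (induction "is")
  case (Cons i "is")
  then show ?case by (cases "is") (simp_all add: path_product_Cons)
qed simp

lemma path_product_prod: "path_product C is = (\<Prod>k<length is - 1. C (is ! k) (is ! Suc k))"
  by (induction C "is" rule: path_product.induct) (simp_all add: prod.lessThan_Suc_shift del: prod.lessThan_Suc)

text \<open>Returning to the first vertex at the end of the list replaces the wraparound of the
  index modulo the length.\<close>

lemma cyclic_product_path:
  assumes "is \<noteq> []"
  shows "cyclic_product C is = path_product C (is @ [hd is])"
proof -
  have *: "(is @ [hd is]) ! Suc k = is ! (Suc k mod length is)" if "k < length is" for k
    using that assms by (cases "Suc k = length is") (auto simp: nth_append hd_conv_nth)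
  show ?thesis
    unfolding path_product_prod cyclic_product_def
  proof (rule prod.cong)
    fix k assume "k \<in> {..<length (is @ [hd is]) - 1}"
    then have k: "k < length is" by simp
    then have "(is @ [hd is]) ! k = is ! k" by (simp add: nth_append)
    then show "C (is ! k) (is ! (Suc k mod length is)) = C ((is @ [hd is]) ! k) ((is @ [hd is]) ! Suc k)"
      unfolding *[OF k] by simp
  qed simp
qed

lemma path_product_cong:
  assumes "\<And>i j. i \<in> set is \<Longrightarrow> j \<in> set is \<Longrightarrow> C i j = D i j"
  shows "path_product C is = path_product D is"
  using assms by (induction C "is" rule: path_product.induct) auto

section \<open>Reflections and cyclic products on an invariant lattice\<close>

locale reflection_system =
  fixes I :: "'i set" and \<sigma> :: "'i \<Rightarrow> 'f::field ^ 'd ^ 'd" and a v :: "'i \<Rightarrow> 'f ^ 'd"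
  assumes finite: "finite I"
    and root: "i \<in> I \<Longrightarrow> vdot (a i) (v i) = 2"
    and two: "(2 :: 'f) \<noteq> 0"
    and reflect: "i \<in> I \<Longrightarrow> \<sigma> i *v x = x - vdot (a i) x *s v i"
begin

definition C :: "'i \<Rightarrow> 'i \<Rightarrow> 'f" where "C i j = vdot (a i) (v j)"

lemma v_nonzero: "i \<in> I \<Longrightarrow> v i \<noteq> 0"
  using root two by fastforce

lemma a_nonzero: "i \<in> I \<Longrightarrow> a i \<noteq> 0"
  using root two by fastforce

text \<open>\<open>mat 1 - \<sigma> i\<close> is the rank one map
  \<open>x \<mapsto> vdot (a i) x *s v i\<close>, so along a nonempty path only the product of
  Cartan entries and the two end vertices survive.\<close>

definition path_matrix :: "'i list \<Rightarrow> 'f ^ 'd ^ 'd" where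
  "path_matrix is = foldr (\<lambda>i M. (mat 1 - \<sigma> i) ** M) is (mat 1)"

lemma path_matrix_vector:
  assumes "is \<noteq> []" "set is \<subseteq> I"
  shows "path_matrix is *v x = (path_product C is * vdot (a (last is)) x) *s v (hd is)"
  using assms
proof (induction "is")
  case (Cons i js)
  have step: "(mat 1 - \<sigma> i) *v y = vdot (a i) y *s v i" for y
    unfolding matrix_vector_mult_diff_rdistrib using Cons.prems reflect[of i y] by simp
  show ?case
  proof (cases "js = []")
    case True
    then show ?thesis using step by (simp add: path_matrix_def)
  next
    case False
    have "path_matrix (i # js) *v x = (mat 1 - \<sigma> i) *v (path_matrix js *v x)"
      by (simp add: path_matrix_def matrix_vector_mul_assoc)
    also have "\<dots> = (path_product C (i # js) * vdot (a (last js)) x) *s v i"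
      using Cons False by (simp add: step path_product_Cons mult_ac flip: C_def)
    finally show ?thesis using False by simp
  qed
qed simp

text \<open>\<open>path_matrix js\<close> sends every vector to a multiple of
  \<open>v (hd js)\<close>, on which it acts by the cyclic product. A lattice vector with nonzero
  image yields an eigenvector inside \<open>L\<close>, and \<open>lattice_eigenvalue\<close>
  applies. If the path product vanishes there is no such vector, but then the cyclic product is
  0.\<close>

lemma cyclic_product_in:
  assumes A: "integrally_closed_noetherian_subring A" and L: "lattice_over A L"
    and inv: "\<And>i x. i \<in> I \<Longrightarrow> x \<in> L \<Longrightarrow> \<sigma> i *v x \<in> L"
    and js: "js \<noteq> []" "set js \<subseteq> I"
  shows "cyclic_product C js \<in> A"
proof (cases "path_product C js = 0")
  case True
  have "subring_of_field A"
    using A by (auto simp: integrally_closed_noetherian_subring_def subring_of_fieldI)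
  then have "0 \<in> A" by (rule subring_of_field.zero)
  moreover have "cyclic_product C js = 0"
    using True js path_product_append[of C "butlast js" "last js" "[hd js]"]
    by (cases js rule: rev_cases) (simp_all add: cyclic_product_path)
  ultimately show ?thesis by simp
next
  case False
  have "subring_of_field A"
    using A by (auto simp: integrally_closed_noetherian_subring_def subring_of_fieldI)
  then interpret A: subring_of_field A .
  have sub: "submodule_over A L" using L by (simp add: lattice_over_def)
  obtain E where E: "det E \<noteq> 0" "\<forall>j. column j E \<in> L"
    by (rule A.lattice_over_basis[OF L])
  have hl: "hd js \<in> I" "last js \<in> I" using js by (auto dest: hd_in_set last_in_set)
  \<comment> \<open>The columns of \<open>E\<close> span the space, so a functional with value 2 at
    \<open>v (last js)\<close> cannot vanish on all of \<open>L\<close>.\<close>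
  have "\<exists>x\<in>L. vdot (a (last js)) x \<noteq> 0"
  proof (rule ccontr)
    assume "\<not> ?thesis"
    then have z: "vdot (a (last js)) (column j E) = 0" for j using E(2) by blast
    obtain c where c: "E *v c = v (last js)" using matrix_surj[OF E(1)] .
    have "E *v c = (\<Sum>j\<in>UNIV. c $ j *s column j E)" by (rule matrix_mult_sum)
    then have "vdot (a (last js)) (E *v c) = 0" using z by (simp add: vdot_sum)
    then show False using c root[OF hl(2)] two by simp
  qed
  then obtain x where x: "x \<in> L" "vdot (a (last js)) x \<noteq> 0" by blast
  have pres: "path_matrix is *v y \<in> L" if "set is \<subseteq> I" "y \<in> L" for y "is"
    using that
  proof (induction "is")
    case (Cons i "is")
    let ?y = "path_matrix is *v y"
    have "?y \<in> L" using Cons by simp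
    moreover have "\<sigma> i *v ?y \<in> L" using \<open>?y \<in> L\<close> inv[of i] Cons.prems by simp
    moreover have "- 1 \<in> A" by (intro A.uminus A.one)
    ultimately have "?y + (- 1) *s (\<sigma> i *v ?y) \<in> L"
      using sub unfolding submodule_over_def by blast
    moreover have "path_matrix (i # is) *v y = ?y + (- 1) *s (\<sigma> i *v ?y)"
      by (simp add: path_matrix_def matrix_vector_mult_diff_rdistrib flip: matrix_vector_mul_assoc)
    ultimately show ?case by simp
  qed (simp add: path_matrix_def)
  have cyc: "cyclic_product C js = path_product C js * vdot (a (last js)) (v (hd js))"
    using js path_product_append[of C "butlast js" "last js" "[hd js]"]
    by (cases js rule: rev_cases) (simp_all add: cyclic_product_path C_def)
  show ?thesis
  proof (rule lattice_eigenvalue[OF A L])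
    show "path_matrix js *v y \<in> L" if "y \<in> L" for y using pres js that by blast
    show "path_matrix js *v x \<in> L" using pres js x by blast
    show "path_matrix js *v x \<noteq> 0"
      unfolding path_matrix_vector[OF js] using x False v_nonzero[OF hl(1)] by simp
    show "path_matrix js *v (path_matrix js *v x) = cyclic_product C js *s (path_matrix js *v x)"
      unfolding path_matrix_vector[OF js] cyc by (simp add: mult_ac)
  qed
qed

end

section \<open>Reduction of paths to simple paths\<close>

lemma path_product_snoc: "is \<noteq> [] \<Longrightarrow> path_product C (is @ [j]) = path_product C is * C (last is) j"
  by (cases "is" rule: rev_cases) (simp_all add: path_product_append[of C _ _ "[j]"])

lemma path_product_join:
  assumes "is \<noteq> []" "js \<noteq> []"
  shows "path_product C (is @ js) = path_product C is * C (last is) (hd js) * path_product C js"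
proof -
  have "path_product C (is @ hd js # tl js) = path_product C (is @ [hd js]) * path_product C (hd js # tl js)"
    by (rule path_product_append)
  then show ?thesis using assms by (simp add: path_product_snoc)
qed

context subring_of_field
begin

text \<open>A repeated vertex closes a simple cycle, whose product can be split off.\<close>

lemma path_product_reduce:
  assumes cyc: "\<And>is. is \<noteq> [] \<Longrightarrow> distinct is \<Longrightarrow> set is \<subseteq> I \<Longrightarrow> cyclic_product C is \<in> A"
    and "is \<noteq> []" "set is \<subseteq> I"
  shows "\<exists>b\<in>A. \<exists>js. js \<noteq> [] \<and> distinct js \<and> set js \<subseteq> I \<and> hd js = hd is \<and> last js = last is \<and>
    path_product C is = b * path_product C js"
  using assms(2,3)
proof (induction "is")
  case (Cons i "is")
  show ?case
  proof (cases "is = []")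
    case True
    then show ?thesis using Cons.prems by (intro bexI[of _ 1] exI[of _ "[i]"]) auto
  next
    case False
    then obtain b js where js: "b \<in> A" "js \<noteq> []" "distinct js" "set js \<subseteq> I" "hd js = hd is"
      "last js = last is" "path_product C is = b * path_product C js"
      using Cons by auto
    then have eq: "path_product C (i # is) = b * path_product C (i # js)"
      using False by (simp add: path_product_Cons)
    show ?thesis
    proof (cases "i \<in> set js")
      case False
      then show ?thesis using js eq Cons.prems \<open>is \<noteq> []\<close>
        by (intro bexI[of _ b] exI[of _ "i # js"]) auto
    next
      case True
      \<comment> \<open>As \<open>js\<close> is distinct, \<open>i # us\<close> is a simple cycle
        and \<open>i # zs\<close> is a simple path with the same end as \<open>js\<close>.\<close>
      then obtain us zs where split: "js = us @ i # zs" by (auto simp: in_set_conv_decomp)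
      have "cyclic_product C (i # us) \<in> A"
        using js Cons.prems split by (intro cyc) auto
      then have "path_product C ((i # us) @ [i]) \<in> A" by (simp add: cyclic_product_path)
      moreover have "path_product C (i # js) = path_product C ((i # us) @ [i]) * path_product C (i # zs)"
        unfolding split using path_product_append[of C "i # us" i zs] by simp
      ultimately show ?thesis using js eq \<open>is \<noteq> []\<close> split
        by (intro bexI[of _ "b * path_product C ((i # us) @ [i])"] exI[of _ "i # zs"])
          (auto intro: mult)
    qed
  qed
qed simp

text \<open>A simple path with equal ends is a single vertex, with path product 1, so after
  reduction only the factor from \<open>A\<close> remains.\<close>

lemma closed_path_product_in:
  assumes cyc: "\<And>is. is \<noteq> [] \<Longrightarrow> distinct is \<Longrightarrow> set is \<subseteq> I \<Longrightarrow> cyclic_product C is \<in> A"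
    and "is \<noteq> []" "set is \<subseteq> I" "hd is = last is"
  shows "path_product C is \<in> A"
proof -
  obtain b js where js: "b \<in> A" "js \<noteq> []" "distinct js" "hd js = hd is" "last js = last is"
    "path_product C is = b * path_product C js"
    using path_product_reduce[OF cyc assms(2,3)] by blast
  have "tl js = []"
  proof (rule ccontr)
    assume "tl js \<noteq> []"
    then have "last js \<in> set (tl js)" by (metis last_in_set last_tl)
    moreover have "hd js \<notin> set (tl js)" using js(2,3) by (cases js) auto
    ultimately show False using js assms(4) by simp
  qed
  then have "path_product C js = 1" using js(2) by (cases js) auto
  then show ?thesis using js by simp
qed

end

section \<open>Invariant lattices spanned by paths\<close>

lemma trace_outer: "trace ((\<chi> i j. w $ i * u $ j) ** g) = vdot u (g *v w)" for g :: "'f::field ^ 'd ^ 'd"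
proof -
  have "trace ((\<chi> i j. w $ i * u $ j) ** g) = (\<Sum>i\<in>UNIV. \<Sum>k\<in>UNIV. w $ i * u $ k * g $ k $ i)"
    by (simp add: trace_def matrix_matrix_mult_def)
  also have "\<dots> = (\<Sum>k\<in>UNIV. \<Sum>i\<in>UNIV. w $ i * u $ k * g $ k $ i)"
    by (rule sum.swap)
  also have "\<dots> = vdot u (g *v w)"
    by (simp add: vdot_def matrix_vector_mult_def sum_distrib_left mult_ac)
  finally show ?thesis .
qed

lemma outer_zero:
  fixes w u :: "'f::field ^ 'd"
  assumes "(\<chi> i j. w $ i * u $ j) = 0"
  shows "w = 0 \<or> u = 0"
  using assms by (auto simp: vec_eq_iff)

lemma submodule_preimage:
  assumes "submodule_over A L" "\<And>x y. f (x + y) = f x + f y" "\<And>c x. f (c *s x) = c *s f x"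
  shows "submodule_over A {x. f x \<in> L}"
  using assms assms(3)[of 0 0] by (auto simp: submodule_over_def)

lemma (in reflection_system) reflection_involution:
  assumes "i \<in> I"
  shows "\<sigma> i ** \<sigma> i = mat 1"
proof -
  have "\<sigma> i *v (\<sigma> i *v x) = x" for x
    using reflect[OF assms] root[OF assms]
    by (simp add: vec.scale_left_diff_distrib)
  then show ?thesis by (simp add: matrix_eq matrix_vector_mul_assoc)
qed

text \<open>\<open>spanning\<close> is density in linear form: every linear functional on matrices
  has the form \<open>trace (c ** g)\<close>, so the condition says that \<open>\<Gamma>\<close>
  spans all matrices.\<close>

locale reflection_group = reflection_system +
  fixes \<Gamma> :: "('b ^ 'c ^ 'c) set"
  assumes reflection_SLpm: "i \<in> I \<Longrightarrow> \<sigma> i \<in> carrier SLpm"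
    and generated: "\<Gamma> = generate SLpm (\<sigma> ` I)"
    and spanning: "(\<And>g. g \<in> \<Gamma> \<Longrightarrow> trace (c ** g) = 0) \<Longrightarrow> c = 0"
begin

text \<open>A reflection is its own inverse, so stability under the generators also covers inverses,
  and \<open>W\<close> may be any set.\<close>

lemma invariant:
  assumes "\<And>i x. i \<in> I \<Longrightarrow> x \<in> W \<Longrightarrow> \<sigma> i *v x \<in> W" "g \<in> \<Gamma>" "x \<in> W"
  shows "g *v x \<in> W"
  using assms(2,3) unfolding generated
proof (induction arbitrary: x rule: generate.induct)
  case one
  then show ?case by (simp add: SLpm_def)
next
  case (incl h)
  then show ?case using assms(1) by auto
next
  case (inv h)
  then obtain i where i: "i \<in> I" "h = \<sigma> i" by auto
  have "inv\<^bsub>SLpm\<^esub> (\<sigma> i) = \<sigma> i"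
    using i reflection_involution reflection_SLpm
    by (intro group.inv_equality group_SLpm) (auto simp: SLpm_def)
  then show ?case using assms(1) i inv.prems by simp
next
  case (eng g h)
  then show ?case by (simp add: SLpm_def flip: matrix_vector_mul_assoc)
qed

theorem definable_if_cyclic_products:
  assumes "subring_of_field A" and i0: "i0 \<in> I"
    and cyc: "\<And>is. is \<noteq> [] \<Longrightarrow> distinct is \<Longrightarrow> set is \<subseteq> I \<Longrightarrow> cyclic_product C is \<in> A"
  shows "definable_over A \<Gamma>"
proof -
  interpret A: subring_of_field A by fact
  \<comment> \<open>A list begins with the latest vertex and ends at \<open>i0\<close>, so a path is
    continued by prepending. Only simple paths serve as generators, which keeps \<open>S\<close>
    finite.\<close>
  define P where "P = {js. js \<noteq> [] \<and> distinct js \<and> set js \<subseteq> I \<and> last js = i0}"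
  define S where "S = (\<lambda>js. path_product C js *s v (hd js)) ` P"
  define T where "T = {path_product C is *s a (last is) | is. is \<noteq> [] \<and> set is \<subseteq> I \<and> hd is = i0}"
  let ?L = "span_over A S"
  have "P \<subseteq> {js. set js \<subseteq> I \<and> distinct js}" by (auto simp: P_def)
  then have finS: "finite S"
    using finite_subset_distinct[OF finite] finite_subset unfolding S_def by blast
  have sub: "submodule_over A ?L" by (rule A.submodule_span_over)
  \<comment> \<open>Reduction to a simple path keeps both ends and costs only a factor from
    \<open>A\<close>, so the vectors of arbitrary paths lie in the span as well.\<close>
  have path: "path_product C is *s v (hd is) \<in> ?L"
    if hyp: "is \<noteq> []" "set is \<subseteq> I" "last is = i0" for "is"
  proof -
    obtain b js where js: "b \<in> A" "js \<in> P" "hd js = hd is"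
      "path_product C is = b * path_product C js"
      using A.path_product_reduce[OF cyc hyp(1,2)] hyp(3) unfolding P_def by blast
    have "path_product C js *s v (hd js) \<in> ?L"
      unfolding S_def by (rule A.span_over_base[OF finS[unfolded S_def]]) (intro imageI js(2))
    then have "b *s (path_product C js *s v (hd js)) \<in> ?L"
      using sub js(1) unfolding submodule_over_def by blast
    then show ?thesis using js by simp
  qed
  have inv: "\<sigma> j *v x \<in> ?L" if "j \<in> I" "x \<in> ?L" for j x
  proof -
    have "submodule_over A {x. vdot (a j) x *s v j \<in> ?L}"
      by (intro submodule_preimage sub) (simp_all add: vec.scale_left_distrib)
    moreover have "S \<subseteq> {x. vdot (a j) x *s v j \<in> ?L}"
    proof
      fix s assume "s \<in> S"
      then obtain js where js: "js \<in> P" "s = path_product C js *s v (hd js)" by (auto simp: S_def)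
      have "path_product C (j # js) *s v j \<in> ?L"
        using path[of "j # js"] js that by (auto simp: P_def)
      moreover have "path_product C (j # js) = vdot (a j) s"
        using js by (simp add: P_def path_product_Cons C_def mult.commute)
      ultimately show "s \<in> {x. vdot (a j) x *s v j \<in> ?L}" by simp
    qed
    ultimately have "vdot (a j) x *s v j \<in> ?L" using span_over_least that(2) by blast
    then have "x + (- 1) *s (vdot (a j) x *s v j) \<in> ?L"
      using sub that(2) A.uminus[OF A.one] unfolding submodule_over_def by blast
    then show ?thesis using reflect[OF that(1), of x] by simp
  qed
  have v0: "v i0 \<in> ?L" using path[of "[i0]"] i0 by simp
  \<comment> \<open>A functional \<open>u\<close> vanishing on the orbit of \<open>v i0\<close>
    gives a matrix of rank at most one that is orthogonal to \<open>\<Gamma>\<close> under the trace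
    pairing, and \<open>spanning\<close> makes it zero.\<close>
  have spanL: "u = 0" if u: "\<And>x. x \<in> ?L \<Longrightarrow> vdot u x = 0" for u
  proof -
    have "vdot u (g *v v i0) = 0" if "g \<in> \<Gamma>" for g
      by (rule u) (rule invariant[of ?L, OF inv that v0])
    then have "(\<chi> i j. v i0 $ i * u $ j) = 0"
      by (intro spanning) (simp add: trace_outer)
    then show ?thesis using outer_zero v_nonzero[OF i0] by blast
  qed
  \<comment> \<open>The annihilator \<open>?W\<close> of \<open>T\<close> is stable under the
    reflections, because extending a path by \<open>j\<close> again gives an element of
    \<open>T\<close>. Thus \<open>a i0\<close> vanishes on the orbit of \<open>u\<close>.\<close>
  have spanT: "u = 0" if u: "\<And>x. x \<in> T \<Longrightarrow> vdot u x = 0" for u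
  proof -
    let ?W = "{y. \<forall>b\<in>T. vdot b y = 0}"
    have "u \<in> ?W" using u by (auto simp: vdot_def mult.commute)
    have W: "\<sigma> j *v y \<in> ?W" if "j \<in> I" "y \<in> ?W" for j y
    proof -
      have "vdot b (\<sigma> j *v y) = 0" if "b \<in> T" for b
      proof -
        obtain "is" where is': "b = path_product C is *s a (last is)" "is \<noteq> []" "set is \<subseteq> I" "hd is = i0"
          using \<open>b \<in> T\<close> by (auto simp: T_def)
        have "path_product C (is @ [j]) *s a j \<in> T"
          unfolding T_def mem_Collect_eq using is' \<open>j \<in> I\<close> by (intro exI[of _ "is @ [j]"]) auto
        then have "path_product C (is @ [j]) * vdot (a j) y = 0"
          using \<open>y \<in> ?W\<close> by force
        moreover have "vdot b y = 0" using \<open>y \<in> ?W\<close> that by blast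
        ultimately show ?thesis
          using is' reflect[OF \<open>j \<in> I\<close>, of y] by (auto simp: path_product_snoc C_def)
      qed
      then show ?thesis by blast
    qed
    have "path_product C [i0] *s a (last [i0]) \<in> T" using i0 unfolding T_def by fastforce
    then have "vdot (a i0) (g *v u) = 0" if "g \<in> \<Gamma>" for g
      using invariant[of ?W, OF W that \<open>u \<in> ?W\<close>] by auto
    then have "(\<chi> i j. u $ i * a i0 $ j) = 0"
      by (intro spanning) (simp add: trace_outer)
    then show ?thesis using outer_zero a_nonzero[OF i0] by blast
  qed
  obtain b where b: "\<And>i. b i \<in> T" "det (\<chi> i. b i) \<noteq> 0"
    using exists_basis_in[of T] spanT by blast
  \<comment> \<open>Joining a path that begins at \<open>i0\<close> with one that ends there gives a
    closed path, whose product lies in \<open>A\<close>.\<close>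
  have TL: "vdot t x \<in> A" if "t \<in> T" "x \<in> ?L" for t x
  proof -
    obtain "is" where is': "t = path_product C is *s a (last is)" "is \<noteq> []" "set is \<subseteq> I" "hd is = i0"
      using \<open>t \<in> T\<close> by (auto simp: T_def)
    have "submodule_over A {x. vdot t x \<in> A}"
      by (auto simp: submodule_over_def A.add A.mult)
    moreover have "S \<subseteq> {x. vdot t x \<in> A}"
    proof
      fix s assume "s \<in> S"
      then obtain js where js: "js \<in> P" "s = path_product C js *s v (hd js)" by (auto simp: S_def)
      have "path_product C (is @ js) \<in> A"
        by (rule A.closed_path_product_in[OF cyc]) (use is' js in \<open>auto simp: P_def\<close>)
      then show "s \<in> {x. vdot t x \<in> A}"
        using is' js by (simp add: path_product_join P_def C_def mult_ac)
    qed
    ultimately show ?thesis using span_over_least that(2) by blast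
  qed
  have "lattice_over A ?L"
  proof (rule A.lattice_overI[OF sub A.finitely_generated_span_over[OF finS] spanL b(2)])
    fix x i assume "x \<in> ?L"
    then have "((\<chi> i. b i) *v x) $ i \<in> A"
      using TL[OF b(1)] by (simp add: matrix_vector_mult_nth)
    then show "((\<chi> i. b i) *v x) $ i \<in> fraction_field_in A" by (rule A.fraction_subset)
  qed
  moreover have "g *v x \<in> ?L" if "g \<in> \<Gamma>" "x \<in> ?L" for g x
    by (rule invariant[of ?L, OF inv that])
  ultimately show ?thesis unfolding definable_over_def by blast
qed

end

section \<open>Subgroups of finite index\<close>

lemma trace_mult: "trace (c ** h) = (\<Sum>i\<in>UNIV. \<Sum>j\<in>UNIV. c $ i $ j * h $ j $ i)"
  by (simp add: trace_def matrix_matrix_mult_def)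

text \<open>
  \<open>s ** h ** s\<close> determines the products of pairs of entries of \<open>s\<close> through a linear system with
  coefficients from \<open>h\<close>; summing over a diagonal entry isolates the entries of \<open>s\<close>.
\<close>

lemma (in subfield_of_field) conjugation_entries:
  fixes s :: "'a ^ 'd ^ 'd"
  assumes spanning: "\<And>c. (\<And>h. h \<in> H \<Longrightarrow> trace (c ** h) = 0) \<Longrightarrow> c = 0"
    and H: "\<And>h i j. h \<in> H \<Longrightarrow> h $ i $ j \<in> A" "\<And>h i j. h \<in> H \<Longrightarrow> (s ** h ** s) $ i $ j \<in> A"
    and tr: "trace s \<in> A" "trace s \<noteq> 0"
  shows "s $ k $ l \<in> A"
proof -
  \<comment> \<open>Matrices are flattened to vectors indexed by pairs, so that
    \<open>exists_basis_in\<close> selects from \<open>H\<close> a basis of the space of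
    matrices.\<close>
  define S :: "('a ^ ('d \<times> 'd)) set" where "S = (\<lambda>h. \<chi> p. h $ fst p $ snd p) ` H"
  have pairs: "(\<Sum>p\<in>UNIV. f (fst p) (snd p)) = (\<Sum>i\<in>UNIV. \<Sum>j\<in>UNIV. f i j)" for f :: "'d \<Rightarrow> 'd \<Rightarrow> 'a"
    by (simp add: sum.cartesian_product case_prod_beta flip: UNIV_Times_UNIV)
  have ann: "u = 0" if u: "\<And>x. x \<in> S \<Longrightarrow> vdot u x = 0" for u
  proof -
    \<comment> \<open>The indices are exchanged because the trace pairs the entry
      \<open>(j, i)\<close> of one matrix with the entry \<open>(i, j)\<close> of the other.\<close>
    let ?c = "\<chi> j i. u $ (i, j)"
    have "trace (?c ** h) = 0" if "h \<in> H" for h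
    proof -
      have "trace (?c ** h) = (\<Sum>j\<in>UNIV. \<Sum>i\<in>UNIV. u $ (i, j) * h $ i $ j)"
        by (simp add: trace_mult)
      also have "\<dots> = (\<Sum>i\<in>UNIV. \<Sum>j\<in>UNIV. u $ (i, j) * h $ i $ j)" by (rule sum.swap)
      also have "\<dots> = (\<Sum>p\<in>UNIV. u $ (fst p, snd p) * h $ fst p $ snd p)" by (rule pairs[symmetric])
      also have "\<dots> = vdot u (\<chi> p. h $ fst p $ snd p)" by (simp add: vdot_def)
      also have "\<dots> = 0" using u that by (simp add: S_def)
      finally show ?thesis .
    qed
    then have "?c = 0" by (rule spanning)
    then show ?thesis by (auto simp: vec_eq_iff)
  qed
  obtain b where b: "\<And>p. b p \<in> S" "det (\<chi> p. b p) \<noteq> 0"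
  proof (rule exists_basis_in[of S])
    show "u = 0" if "\<And>x. x \<in> S \<Longrightarrow> vdot u x = 0" for u using that by (rule ann)
  qed (rule that)
  have prods: "s $ k $ i * s $ j $ l \<in> A" for k i j l
  proof -
    \<comment> \<open>For fixed \<open>k\<close> and \<open>l\<close> the products are the unknowns;
      the equation coming from \<open>h\<close> is the entry \<open>(k, l)\<close> of
      \<open>s ** h ** s\<close>.\<close>
    let ?x = "\<chi> p. s $ k $ fst p * s $ snd p $ l"
    have "?x $ (i, j) \<in> A"
    proof (rule linear_system[OF b(2)])
      fix p q
      obtain h where h: "h \<in> H" "b p = (\<chi> q. h $ fst q $ snd q)" using b(1)[of p] by (auto simp: S_def)
      then show "(\<chi> p. b p) $ p $ q \<in> A" using H(1) by simp
      have "((\<chi> p. b p) *v ?x) $ p = (\<Sum>q\<in>UNIV. h $ fst q $ snd q * (s $ k $ fst q * s $ snd q $ l))"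
        by (simp add: matrix_vector_mult_nth vdot_def h)
      also have "\<dots> = (\<Sum>i\<in>UNIV. \<Sum>j\<in>UNIV. h $ i $ j * (s $ k $ i * s $ j $ l))"
        by (rule pairs)
      also have "\<dots> = (\<Sum>j\<in>UNIV. \<Sum>i\<in>UNIV. h $ i $ j * (s $ k $ i * s $ j $ l))" by (rule sum.swap)
      also have "\<dots> = (s ** h ** s) $ k $ l"
        by (simp add: matrix_matrix_mult_def sum_distrib_left sum_distrib_right mult_ac)
      also have "\<dots> \<in> A" using H(2) h by blast
      finally show "((\<chi> p. b p) *v ?x) $ p \<in> A" .
    qed
    then show ?thesis by simp
  qed
  have "trace s * s $ k $ l = (\<Sum>j\<in>UNIV. s $ k $ l * s $ j $ j)"
    by (simp add: trace_def sum_distrib_left mult.commute)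
  also have "\<dots> \<in> A" by (intro sum prods)
  finally have "trace s * s $ k $ l / trace s \<in> A" using tr(1) by (rule divide)
  then show ?thesis using tr(2) by simp
qed

text \<open>The rank one part subtracted from the identity has trace
  \<open>vdot (a i) (v i)\<close>, which is 2.\<close>

lemma (in reflection_system) trace_reflection:
  assumes "i \<in> I"
  shows "trace (\<sigma> i) = of_nat CARD('d) - 2"
proof -
  have "\<sigma> i $ j $ j = 1 - a i $ j * v i $ j" for j
  proof -
    have "\<sigma> i $ j $ j = (\<sigma> i *v axis j 1) $ j"
      by (simp only: matrix_vector_mult_nth vdot_axis)
    also have "\<dots> = 1 - a i $ j * v i $ j" using reflect[OF assms, of "axis j 1"] by (simp add: vdot_axis)
    finally show ?thesis .
  qed
  then have "trace (\<sigma> i) = (\<Sum>j\<in>(UNIV :: 'd set). 1) - vdot (a i) (v i)"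
    by (simp add: trace_def vdot_def sum_subtractf)
  then show ?thesis using root[OF assms] by simp
qed

context reflection_group
begin

text \<open>\<open>sp\<close> says that the elements of \<open>\<Delta>\<close> that stay in
  \<open>\<Delta>\<close> under conjugation by \<open>\<sigma> i\<close> span all matrices, and
  \<open>card\<close> makes the trace of a reflection nonzero. Together they give the reflections,
  hence all of \<open>\<Gamma>\<close>, entries in \<open>?K\<close> with respect to a lattice
  basis. A sum of finitely many translates of \<open>L\<close> is then an invariant lattice.\<close>

theorem definable_if_finite_index:
  assumes "subring_of_field A" and \<Delta>: "\<Delta> \<subseteq> \<Gamma>" and def: "definable_over A \<Delta>"
    and R: "Finite_Set.finite R" "R \<subseteq> \<Gamma>" "\<And>g. g \<in> \<Gamma> \<Longrightarrow> \<exists>r\<in>R. r ** g \<in> \<Delta>"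
    and sp: "\<And>i c. i \<in> I \<Longrightarrow>
      (\<And>g. g \<in> \<Delta> \<Longrightarrow> \<sigma> i ** g ** \<sigma> i \<in> \<Delta> \<Longrightarrow> trace (c ** g) = 0) \<Longrightarrow> c = 0"
    and card: "(of_nat CARD('c) :: 'b) \<noteq> 2"
  shows "definable_over A \<Gamma>"
proof -
  interpret A: subring_of_field A by fact
  let ?K = "fraction_field_in A"
  interpret K: subfield_of_field ?K by (rule A.subfield_fraction_field)
  obtain L where L: "lattice_over A L" "\<And>g x. g \<in> \<Delta> \<Longrightarrow> x \<in> L \<Longrightarrow> g *v x \<in> L"
    using def unfolding definable_over_def by blast
  obtain E where E: "det E \<noteq> 0" "\<forall>j. column j E \<in> L"
    "\<forall>c. E *v c \<in> L \<longrightarrow> (\<forall>i. c $ i \<in> ?K)"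
    by (rule A.lattice_over_basis[OF L(1)])
  then obtain F where F: "F ** E = mat 1" "E ** F = mat 1"
    using invertible_det_nz[of E] unfolding invertible_def by blast
  have EF: "E *v (F *v x) = x" for x using F by (simp add: matrix_vector_mul_assoc)
  have FL: "(F *v x) $ i \<in> ?K" if "x \<in> L" for x i
    using E(3) that by (simp add: EF)
  \<comment> \<open>The matrix of \<open>g\<close> in the lattice basis formed by the columns of
    \<open>E\<close>.\<close>
  define conj where "conj g = F ** g ** E" for g
  have conj_mult: "conj g ** conj h = conj (g ** h)" for g h
  proof -
    have "conj g ** conj h = F ** g ** (E ** F) ** h ** E" by (simp add: conj_def matrix_mul_assoc)
    then show ?thesis by (simp add: F conj_def matrix_mul_assoc)
  qed
  have conj_\<Delta>: "conj g $ i $ j \<in> ?K" if "g \<in> \<Delta>" for g i j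
  proof -
    have "conj g $ i $ j = column j (F ** (g ** E)) $ i"
      by (simp add: conj_def column_def matrix_mul_assoc)
    also have "\<dots> = (F *v (g *v column j E)) $ i"
      by (simp add: column_def matrix_matrix_mult_def matrix_vector_mult_def)
    also have "\<dots> \<in> ?K" using E(2) L(2)[OF that] by (intro FL) blast
    finally show ?thesis .
  qed
  have conj_\<sigma>: "conj (\<sigma> i) $ k $ l \<in> ?K" if i: "i \<in> I" for i k l
  proof (rule K.conjugation_entries)
    let ?H = "{g \<in> \<Delta>. \<sigma> i ** g ** \<sigma> i \<in> \<Delta>}"
    show "c = 0" if c: "\<And>h. h \<in> conj ` ?H \<Longrightarrow> trace (c ** h) = 0" for c
    proof -
      \<comment> \<open>By cyclicity of the trace, pairing \<open>c\<close> with
        \<open>conj g\<close> is pairing \<open>E ** c ** F\<close> with \<open>g\<close>, so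
        \<open>sp\<close> applies to the latter matrix.\<close>
      have "E ** c ** F = 0"
      proof (rule sp[OF i])
        fix g assume "g \<in> \<Delta>" "\<sigma> i ** g ** \<sigma> i \<in> \<Delta>"
        then have "trace (c ** conj g) = 0" using c by blast
        moreover have "trace (c ** conj g) = trace ((c ** F ** g) ** E)"
          by (simp add: conj_def matrix_mul_assoc)
        moreover have "\<dots> = trace (E ** c ** F ** g)"
          unfolding trace_mul_sym[of _ E] by (simp add: matrix_mul_assoc)
        ultimately show "trace (E ** c ** F ** g) = 0" by simp
      qed
      then have "F ** (E ** c ** F) ** E = 0" by simp
      moreover have "F ** (E ** c ** F) ** E = (F ** E) ** c ** (F ** E)"
        by (simp only: matrix_mul_assoc)
      ultimately show ?thesis by (simp add: F)
    qed
    show "h $ k $ l \<in> ?K" if "h \<in> conj ` ?H" for h k l using that conj_\<Delta> by auto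
    show "(conj (\<sigma> i) ** h ** conj (\<sigma> i)) $ k $ l \<in> ?K" if "h \<in> conj ` ?H" for h k l
      using that conj_\<Delta> by (auto simp: conj_mult)
    have "trace (conj (\<sigma> i)) = trace (E ** (F ** \<sigma> i))"
      unfolding conj_def by (rule trace_mul_sym)
    then have tr: "trace (conj (\<sigma> i)) = of_nat CARD('c) - 2"
      by (simp add: matrix_mul_assoc F trace_reflection[OF i])
    show "trace (conj (\<sigma> i)) \<noteq> 0" using card tr by simp
    show "trace (conj (\<sigma> i)) \<in> ?K"
      unfolding tr using K.diff[OF K.of_nat K.of_nat[of 2]] by simp
  qed
  have conj_vec: "conj g *v (F *v x) = F *v (g *v x)" for g x
  proof -
    have "conj g *v (F *v x) = F *v (g *v (E *v (F *v x)))"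
      by (simp only: conj_def matrix_vector_mul_assoc matrix_mul_assoc)
    then show ?thesis by (simp only: EF)
  qed
  have \<Gamma>K: "(F *v (g *v x)) $ k \<in> ?K" if "g \<in> \<Gamma>" "\<And>k. (F *v x) $ k \<in> ?K" for g x k
  proof -
    let ?W = "{x. \<forall>k. (F *v x) $ k \<in> ?K}"
    have "\<sigma> i *v x \<in> ?W" if "i \<in> I" "x \<in> ?W" for i x
    proof -
      have "(F *v (\<sigma> i *v x)) $ k \<in> ?K" for k
        unfolding conj_vec[symmetric] matrix_vector_mult_nth
        by (rule K.vdot) (use conj_\<sigma> that in auto)
      then show ?thesis by blast
    qed
    then have "g *v x \<in> ?W" by (rule invariant) (use that in auto)
    then show ?thesis by blast
  qed
  have carr: "g \<in> carrier SLpm" if "g \<in> \<Gamma>" for g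
    using group.generate_in_carrier[OF group_SLpm, of "\<sigma> ` I" g] reflection_SLpm that
    by (auto simp: generated)
  have sg: "subgroup \<Gamma> SLpm"
    unfolding generated using reflection_SLpm by (intro group.generate_is_subgroup group_SLpm) auto
  define minv where "minv g = inv\<^bsub>SLpm\<^esub> g" for g :: "'b ^ 'c ^ 'c"
  have minv: "minv g \<in> \<Gamma>" "minv g ** g = mat 1" "g ** minv g = mat 1" if "g \<in> \<Gamma>" for g
    using subgroup.m_inv_closed[OF sg that] group.l_inv[OF group_SLpm carr[OF that]]
      group.r_inv[OF group_SLpm carr[OF that]]
    by (simp_all add: minv_def SLpm_def)
  have one: "mat 1 \<in> \<Gamma>" using subgroup.one_closed[OF sg] by (simp add: SLpm_def)
  have mult: "g ** h \<in> \<Gamma>" if "g \<in> \<Gamma>" "h \<in> \<Gamma>" for g h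
    using subgroup.m_closed[OF sg that] by (simp add: SLpm_def)
  obtain S where S: "Finite_Set.finite S" "S \<subseteq> L" "L = span_over A S"
    using L(1) unfolding lattice_over_def finitely_generated_over_iff by (elim exE conjE)
  \<comment> \<open>\<open>r ** g \<in> \<Delta>\<close> places \<open>g\<close> in the translate of
    \<open>\<Delta>\<close> by the inverse of \<open>r\<close>, hence the inverses. The identity is
    added so that \<open>L\<close> itself lies in the new module.\<close>
  define R' where "R' = insert (mat 1) (minv ` R)"
  have R'\<Gamma>: "r \<in> \<Gamma>" if "r \<in> R'" for r using that R(2) one minv(1) by (auto simp: R'_def)
  define S' where "S' = (\<lambda>(r, s). r *v s) ` (R' \<times> S)"
  let ?L = "span_over A S'"
  have finS': "Finite_Set.finite S'" using R(1) S(1) by (simp add: S'_def R'_def)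
  have sub: "submodule_over A ?L" by (rule A.submodule_span_over)
  have RL: "r *v x \<in> ?L" if "r \<in> R'" "x \<in> L" for r x
  proof -
    have "submodule_over A {x. r *v x \<in> ?L}"
      by (intro submodule_preimage sub) (simp_all add: vec.scale matrix_vector_right_distrib)
    moreover have "S \<subseteq> {x. r *v x \<in> ?L}"
    proof
      fix s assume "s \<in> S"
      then have "r *v s \<in> S'" using that(1) by (auto simp: S'_def)
      then show "s \<in> {x. r *v x \<in> ?L}" using A.span_over_base[OF finS'] by blast
    qed
    ultimately have "span_over A S \<subseteq> {x. r *v x \<in> ?L}" by (rule span_over_least)
    then show ?thesis using that S(3) by blast
  qed
  have inv: "g *v x \<in> ?L" if g: "g \<in> \<Gamma>" and x: "x \<in> ?L" for g x
  proof -
    have "submodule_over A {x. g *v x \<in> ?L}"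
      by (intro submodule_preimage sub) (simp_all add: vec.scale matrix_vector_right_distrib)
    moreover have "S' \<subseteq> {x. g *v x \<in> ?L}"
    proof
      fix y assume "y \<in> S'"
      then obtain r s where rs: "r \<in> R'" "s \<in> S" "y = r *v s" by (auto simp: S'_def)
      have "g ** r \<in> \<Gamma>" using mult g R'\<Gamma> rs by blast
      then obtain q where q: "q \<in> R" "q ** (g ** r) \<in> \<Delta>" using R(3) by blast
      \<comment> \<open>\<open>q\<close> moves \<open>g ** r\<close> into \<open>\<Delta>\<close>,
        which preserves \<open>L\<close>; the inverse of \<open>q\<close> then leads into one of the
        chosen translates.\<close>
      have "minv q *v ((q ** (g ** r)) *v s) \<in> ?L"
        using q rs S(2) by (intro RL L(2)) (auto simp: R'_def)
      moreover have "minv q *v ((q ** (g ** r)) *v s) = (minv q ** q) *v (g *v y)"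
        by (simp only: rs matrix_vector_mul_assoc matrix_mul_assoc)
      moreover have "q \<in> \<Gamma>" using q R(2) by blast
      ultimately show "y \<in> {x. g *v x \<in> ?L}" by (simp add: minv)
    qed
    ultimately have "?L \<subseteq> {x. g *v x \<in> ?L}" by (rule span_over_least)
    then show ?thesis using x by blast
  qed
  have "lattice_over A ?L"
  proof (rule A.lattice_overI[OF sub A.finitely_generated_span_over[OF finS']])
    fix u assume u: "\<And>x. x \<in> ?L \<Longrightarrow> vdot u x = 0"
    have "vdot u (column j E) = 0" for j
      using u RL[of "mat 1" "column j E"] E(2) by (simp add: R'_def)
    then have "vdot u (E *v c) = 0" for c
      by (simp add: matrix_mult_sum vdot_sum)
    from this[of "F *v axis i 1" for i] show "u = 0"
      by (simp add: EF vdot_axis vec_eq_iff)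
  next
    have "det F * det E = 1" using F(1) by (metis det_I det_mul)
    then show "det F \<noteq> 0" by auto
  next
    fix x i assume "x \<in> ?L"
    have "submodule_over A {x. \<forall>i. (F *v x) $ i \<in> ?K}"
      by (auto simp: submodule_over_def matrix_vector_right_distrib vec.scale
          intro: K.add K.mult A.fraction_subset)
    moreover have "S' \<subseteq> {x. \<forall>i. (F *v x) $ i \<in> ?K}"
    proof
      fix y assume "y \<in> S'"
      then obtain r s where "r \<in> R'" "s \<in> S" "y = r *v s" by (auto simp: S'_def)
      then show "y \<in> {x. \<forall>i. (F *v x) $ i \<in> ?K}" using \<Gamma>K[OF R'\<Gamma> FL] S(2) by blast
    qed
    ultimately show "(F *v x) $ i \<in> ?K" using span_over_least \<open>x \<in> ?L\<close> by blast
  qed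
  then show ?thesis using inv unfolding definable_over_def by blast
qed

end

section \<open>Coset representatives and the equivalences\<close>

lemma finite_image_representatives:
  assumes "finite (f ` S)"
  shows "\<exists>R\<subseteq>S. finite R \<and> (\<forall>x\<in>S. \<exists>r\<in>R. f x = f r)"
proof -
  obtain R where "R \<subseteq> S" "finite R" "f ` S = f ` R"
    using finite_subset_image[OF assms order_refl] by blast
  then show ?thesis by (intro exI[of _ R]) blast
qed

lemma linear_functional_vdot:
  fixes \<alpha> :: "'f::field ^ 'd \<Rightarrow> 'f"
  assumes "Vector_Spaces.linear (*s) (*) \<alpha>"
  shows "\<alpha> x = vdot (\<chi> k. \<alpha> (axis k 1)) x"
proof -
  interpret l: Vector_Spaces.linear "(*s)" "(*)" \<alpha> by fact
  have "\<alpha> x = \<alpha> (\<Sum>k\<in>UNIV. x $ k *s axis k 1)" by (simp add: basis_expansion)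
  also have "\<dots> = (\<Sum>k\<in>UNIV. x $ k * \<alpha> (axis k 1))" by (simp add: l.sum l.scale)
  also have "\<dots> = vdot (\<chi> k. \<alpha> (axis k 1)) x" by (simp add: vdot_def mult.commute)
  finally show ?thesis .
qed

theorem theorem5p4:
  fixes n :: nat
    and \<Gamma> \<Delta> :: "('f::{alg_closed_field, field_char_0} ^ 'd ^ 'd) set"
    and I :: "'i set"
    and \<sigma> :: "'i \<Rightarrow> 'f ^ 'd ^ 'd"
    and \<alpha> :: "'i \<Rightarrow> 'f ^ 'd \<Rightarrow> 'f"
    and v :: "'i \<Rightarrow> 'f ^ 'd"
    and A :: "'f set"
  assumes "n \<ge> 2" and "CARD('d) = n + 1"
    and "finite I"
    and "\<And>i. i \<in> I \<Longrightarrow> reflection (\<sigma> i)"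
    and "\<And>i. i \<in> I \<Longrightarrow> reflection_form (\<sigma> i) (\<alpha> i) (v i)"
    and "\<Gamma> = generate SLpm (\<sigma> ` I)"
    and "zariski_dense_in_SLpm \<Gamma>"
    and "subgroup \<Delta> (SLpm\<lparr>carrier := \<Gamma>\<rparr>)"
    and "finite (rcosets\<^bsub>SLpm\<lparr>carrier := \<Gamma>\<rparr>\<^esub> \<Delta>)"
    and "integrally_closed_noetherian_subring A"
  shows "(definable_over A \<Gamma> \<longleftrightarrow> simple_cyclic_products I (cartan_matrix \<alpha> v) \<subseteq> A) \<and>
         (definable_over A \<Gamma> \<longleftrightarrow> definable_over A \<Delta>)"
proof -
  define a where "a i = (\<chi> k. \<alpha> i (axis k 1))" for i
  have \<alpha>: "\<alpha> i x = vdot (a i) x" if "i \<in> I" for i x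
    using linear_functional_vdot[of "\<alpha> i" x] assms(5)[OF that]
    unfolding a_def reflection_form_def by blast
  interpret reflection_system I \<sigma> a v
    by unfold_locales (use assms(3,5) in \<open>simp_all add: reflection_form_def flip: \<alpha>\<close>)
  interpret reflection_group I \<sigma> a v \<Gamma>
  proof
    show "\<sigma> i \<in> carrier SLpm" if "i \<in> I" for i using assms(4)[OF that] by (simp add: reflection_def)
    show "\<Gamma> = generate SLpm (\<sigma> ` I)" by fact
    \<comment> \<open>The case of a single translate: \<open>\<Gamma>\<close> is covered by itself,
      with the identity as the only representative.\<close>
    show "c = 0" if "\<And>g. g \<in> \<Gamma> \<Longrightarrow> trace (c ** g) = 0" for c
      by (rule dense_no_linear_form[OF assms(7), of "{mat 1}" \<Gamma>]) (use that in \<open>auto simp: invertible_def\<close>)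
  qed
  have ring: "subring_of_field A"
    using assms(10) by (simp add: integrally_closed_noetherian_subring_def subring_of_fieldI)
  have carr: "g \<in> carrier SLpm" if "g \<in> \<Gamma>" for g
    using assms(7) that by (auto simp: zariski_dense_in_SLpm_def)
  have sg: "subgroup \<Gamma> SLpm"
    unfolding generated using reflection_SLpm by (intro group.generate_is_subgroup group_SLpm) auto
  have mult: "g ** h \<in> \<Gamma>" if "g \<in> \<Gamma>" "h \<in> \<Gamma>" for g h
    using subgroup.m_closed[OF sg that] by (simp add: SLpm_def)
  have \<sigma>\<Gamma>: "\<sigma> i \<in> \<Gamma>" if "i \<in> I" for i
    using that unfolding generated by (intro generate.incl imageI)
  have inverse: "\<exists>h\<in>\<Gamma>. h ** g = mat 1 \<and> g ** h = mat 1" if "g \<in> \<Gamma>" for g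
    using subgroup.m_inv_closed[OF sg that] group.l_inv[OF group_SLpm carr[OF that]]
      group.r_inv[OF group_SLpm carr[OF that]]
    by (auto simp: SLpm_def intro!: bexI[of _ "inv\<^bsub>SLpm\<^esub> g"])
  have \<Delta>: "\<Delta> \<subseteq> \<Gamma>" "mat 1 \<in> \<Delta>"
    using subgroup.subset[OF assms(8)] subgroup.one_closed[OF assms(8)] by (auto simp: SLpm_def)
  define coset where "coset g = (\<lambda>d. d ** g) ` \<Delta>" for g :: "'f ^ 'd ^ 'd"
  have coset_fin: "finite (coset ` \<Gamma>)"
  proof (rule finite_subset[OF _ assms(9)])
    show "coset ` \<Gamma> \<subseteq> rcosets\<^bsub>SLpm\<lparr>carrier := \<Gamma>\<rparr>\<^esub> \<Delta>"
      by (auto simp: coset_def RCOSETS_def r_coset_def SLpm_def)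
  qed
  have coset_eq: "\<exists>d\<in>\<Delta>. g = d ** h" if "coset g = coset h" for g h
  proof -
    have "mat 1 ** g \<in> coset g" using \<Delta>(2) unfolding coset_def by (rule imageI)
    then show ?thesis using that by (auto simp: coset_def)
  qed

  have "CARD('d) \<noteq> 1" using assms(1,2) by simp
  \<comment> \<open>Without reflections the group is trivial, and an off-diagonal matrix unit would
    violate \<open>spanning\<close>; such a unit exists because there are at least two
    indices.\<close>
  have "I \<noteq> {}"
  proof
    assume "I = {}"
    then have \<Gamma>1: "\<Gamma> = {mat 1}"
      unfolding generated using group.generate_empty[OF group_SLpm] by (simp add: SLpm_def)
    have "(UNIV :: 'd set) \<noteq> {undefined}"
      using \<open>CARD('d) \<noteq> 1\<close> by (metis card_1_singleton_iff One_nat_def)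
    then obtain p q :: 'd where "p \<noteq> q" by blast
    let ?c = "(\<chi> i j. if i = p \<and> j = q then 1 else 0) :: 'f ^ 'd ^ 'd"
    have "trace ?c = 0" using \<open>p \<noteq> q\<close> unfolding trace_def by (intro sum.neutral) auto
    then have "?c = 0" by (intro spanning) (simp add: \<Gamma>1)
    then have "?c $ p $ q = 0" by simp
    then show False by simp
  qed
  then obtain i0 where i0: "i0 \<in> I" by blast

  have cyc_eq: "cyclic_product (cartan_matrix \<alpha> v) is = cyclic_product C is"
    if "is \<noteq> []" "set is \<subseteq> I" for "is"
  proof -
    have "set (is @ [hd is]) \<subseteq> I" using that by (auto dest: hd_in_set)
    then show ?thesis
      unfolding cyclic_product_path[OF that(1)]
      by (intro path_product_cong) (use \<alpha> in \<open>auto simp: cartan_matrix_def C_def\<close>)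
  qed
  have ab: "simple_cyclic_products I (cartan_matrix \<alpha> v) \<subseteq> A" if "definable_over A \<Gamma>"
  proof -
    obtain L where L: "lattice_over A L" "\<forall>g\<in>\<Gamma>. \<forall>x\<in>L. g *v x \<in> L"
      using \<open>definable_over A \<Gamma>\<close> unfolding definable_over_def by blast
    have "cyclic_product C js \<in> A" if "js \<noteq> []" "set js \<subseteq> I" for js
      using L \<sigma>\<Gamma> that by (intro cyclic_product_in[OF assms(10) L(1)]) auto
    then show ?thesis
      using cyc_eq by (auto simp: simple_cyclic_products_def)
  qed
  have ba: "definable_over A \<Gamma>" if "simple_cyclic_products I (cartan_matrix \<alpha> v) \<subseteq> A"
  proof (rule definable_if_cyclic_products[OF ring i0])
    fix js assume js: "js \<noteq> []" "distinct js" "set js \<subseteq> I"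
    then have "cyclic_product (cartan_matrix \<alpha> v) js \<in> simple_cyclic_products I (cartan_matrix \<alpha> v)"
      by (auto simp: simple_cyclic_products_def)
    then show "cyclic_product C js \<in> A" using that cyc_eq js by auto
  qed
  have ac: "definable_over A \<Delta>" if "definable_over A \<Gamma>"
    using that \<Delta>(1) unfolding definable_over_def by blast
  have ca: "definable_over A \<Gamma>" if def: "definable_over A \<Delta>"
  proof -
    obtain R where R: "R \<subseteq> \<Gamma>" "finite R" "\<forall>g\<in>\<Gamma>. \<exists>r\<in>R. coset g = coset r"
      using finite_image_representatives[OF coset_fin] by blast
    show ?thesis
    proof (rule definable_if_finite_index[OF ring \<Delta>(1) def R(2,1)])
      fix g assume "g \<in> \<Gamma>"
      \<comment> \<open>The representative is taken for the coset of the inverse \<open>h\<close> of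
        \<open>g\<close>: from \<open>r = d ** h\<close> it follows that
        \<open>r ** g = d\<close>.\<close>
      then obtain h where h: "h \<in> \<Gamma>" "h ** g = mat 1" using inverse by blast
      then obtain r where r: "r \<in> R" "coset h = coset r" using R(3) by blast
      then obtain d where "d \<in> \<Delta>" "r = d ** h" using coset_eq[of r h] by auto
      then have "r ** g \<in> \<Delta>" using h by (simp flip: matrix_mul_assoc)
      then show "\<exists>r\<in>R. r ** g \<in> \<Delta>" using r by blast
    next
      show "(of_nat CARD('d) :: 'f) \<noteq> 2"
      proof -
        \<comment> \<open>Here \<open>n \<ge> 2\<close> is essential: in dimension 2 every
          reflection has trace 0.\<close>
        have "CARD('d) \<noteq> 2" using assms(1,2) by simp
        then show ?thesis by (metis of_nat_eq_iff of_nat_numeral)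
      qed
    next
      fix i c assume i: "i \<in> I"
        and c: "\<And>g. g \<in> \<Delta> \<Longrightarrow> \<sigma> i ** g ** \<sigma> i \<in> \<Delta> \<Longrightarrow> trace (c ** g) = 0"
      define H where "H = {g \<in> \<Delta>. \<sigma> i ** g ** \<sigma> i \<in> \<Delta>}"
      have \<sigma>\<sigma>: "\<sigma> i ** \<sigma> i = mat 1" by (rule reflection_involution[OF i])
      \<comment> \<open>If \<open>g\<close> and \<open>r\<close> have the same pair of cosets, then
        \<open>g\<close> times the inverse of \<open>r\<close> lies in \<open>H\<close>. There are
        only finitely many pairs, so \<open>H\<close> has finite index in \<open>\<Gamma>\<close>,
        and the inverses \<open>m r\<close> of the representatives serve as translates.\<close>
      let ?f = "\<lambda>g. (coset g, coset (\<sigma> i ** g ** \<sigma> i))"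
      have "?f ` \<Gamma> \<subseteq> coset ` \<Gamma> \<times> coset ` \<Gamma>" using mult \<sigma>\<Gamma>[OF i] by blast
      then have "finite (?f ` \<Gamma>)" using coset_fin finite_subset by blast
      then obtain R where R: "R \<subseteq> \<Gamma>" "finite R" "\<forall>g\<in>\<Gamma>. \<exists>r\<in>R. ?f g = ?f r"
        using finite_image_representatives[of ?f \<Gamma>] by blast
      have "\<forall>g. \<exists>h. g \<in> \<Gamma> \<longrightarrow> h ** g = mat 1 \<and> g ** h = mat 1" using inverse by blast
      then obtain m where m: "\<And>g. g \<in> \<Gamma> \<Longrightarrow> m g ** g = mat 1" "\<And>g. g \<in> \<Gamma> \<Longrightarrow> g ** m g = mat 1"
        by metis
      show "c = 0"
      proof (rule dense_no_linear_form[OF assms(7), of "m ` R" H])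
        show "finite (m ` R)" using R by simp
        show "invertible r" if "r \<in> m ` R" for r
          using that R(1) m unfolding invertible_def by blast
        show "trace (c ** h) = 0" if "h \<in> H" for h using that c by (simp add: H_def)
        fix g assume "g \<in> \<Gamma>"
        then obtain r where r: "r \<in> R" "coset g = coset r"
          "coset (\<sigma> i ** g ** \<sigma> i) = coset (\<sigma> i ** r ** \<sigma> i)" using R(3) by blast
        then have rm: "r ** m r = mat 1" using R(1) m by blast
        obtain d where d: "d \<in> \<Delta>" "g = d ** r" using coset_eq r(2) by blast
        obtain e where e: "e \<in> \<Delta>" "\<sigma> i ** g ** \<sigma> i = e ** (\<sigma> i ** r ** \<sigma> i)"
          using coset_eq r(3) by blast
        have "g ** m r = d" using rm d by (simp flip: matrix_mul_assoc)
        moreover have "\<sigma> i ** (g ** m r) ** \<sigma> i = e"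
        proof -
          have "\<sigma> i ** (g ** m r) ** \<sigma> i = (\<sigma> i ** g ** \<sigma> i) ** (\<sigma> i ** m r ** \<sigma> i)"
            by (metis \<sigma>\<sigma> matrix_mul_assoc matrix_mul_rid)
          also have "\<dots> = e ** (\<sigma> i ** (r ** ((\<sigma> i ** \<sigma> i) ** m r)) ** \<sigma> i)"
            unfolding e(2) by (simp only: matrix_mul_assoc)
          also have "\<dots> = e" by (simp add: \<sigma>\<sigma> rm)
          finally show ?thesis .
        qed
        ultimately have "g ** m r \<in> H" using d e by (simp add: H_def)
        then show "\<exists>r\<in>m ` R. g ** r \<in> H" using r(1) by blast
      qed
    qed
  qed
  show ?thesis using ab ba ac ca by blast
qed

end
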